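(* Let $n\ge 1$. Then $$\sum_{d\mid n} p_d^{\,n/d}=\sum_{k\mid n} a_k(n)\,\ell_n^{(n/k)},$$ where $a_k(n)=\sum_{d\mid n} c_k(n/d)$. Moreover, the symmetric function $\sum_{d\mid n} p_d^{\,n/d}$ is Schur positive.
   Context: $p_d$ is the $d$th power sum symmetric function. For positive integers $d,r$, the Ramanujan sum is $c_d(r)=\sum_{1\le m\le d,\ (m,d)=1}\exp(2\pi i m r/d)$. Let $C_n$ be the cyclic subgroup of the symmetric group $\mathfrak{S}_n$ generated by the long cycle $(1,2,\ldots,n)$; for $1\le r\le n$, $\ell_n^{(r)}$ denotes the Frobenius characteristic of the representation of $\mathfrak{S}_n$ induced from the one-dimensional character of $C_n$ sending the long cycle to $\exp(2\pi i r/n)$. A symmetric function homogeneous of degree $n$ is called Schur positive if it is a nonnegative integer combination of Schur functions (equivalently, the Frobenius characteristic of a true $\mathfrak{S}_n$-module). *)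

theory Defs
  imports
    Complex_Main
    "HOL-Library.Poly_Mapping"
    "HOL-Combinatorics.Orbits"
    "HOL-Combinatorics.Cycles"
    "HOL-Algebra.Sym_Groups"
    "HOL-Algebra.Left_Coset"
begin

text \<open>
  Symmetric functions live in the ring of formal power series in variables
  \<open>x\<^sub>0, x\<^sub>1, x\<^sub>2, \<dots>\<close>. A monomial is a finitely supported exponent vector.
\<close>

type_synonym mono = "nat \<Rightarrow>\<^sub>0 nat"

typedef 'a mps = "UNIV :: (mono \<Rightarrow> 'a) set"
  morphisms mcoeff Abs_mps ..

setup_lifting type_definition_mps

lemma finite_mono_splits: "finite {p :: mono \<times> mono. fst p + snd p = m}"
proof -
  let ?K = "Poly_Mapping.keys m"
  let ?F = "{g. \<forall>i. (i \<in> ?K \<longrightarrow> g i \<in> (\<Union>j\<in>?K. {..Poly_Mapping.lookup m j})) \<and> (i \<notin> ?K \<longrightarrow> g i = (0::nat))}"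
  let ?A = "{a :: mono. \<forall>i. Poly_Mapping.lookup a i \<le> Poly_Mapping.lookup m i}"
  have "finite ?F"
    by (rule finite_set_of_finite_funs) simp_all
  moreover have "Poly_Mapping.lookup ` ?A \<subseteq> ?F"
  proof (rule image_subsetI, rule CollectI, intro allI conjI impI)
    fix a i assume "a \<in> ?A"
    then have a: "Poly_Mapping.lookup a i \<le> Poly_Mapping.lookup m i"
      by simp
    show "Poly_Mapping.lookup a i = 0" if "i \<notin> ?K"
      using a that by (simp add: in_keys_iff)
    show "Poly_Mapping.lookup a i \<in> (\<Union>j\<in>?K. {..Poly_Mapping.lookup m j})" if "i \<in> ?K"
      using that a by (intro UN_I[of i]) simp_all
  qed
  ultimately have "finite (Poly_Mapping.lookup ` ?A)"
    by (metis (lifting) finite_subset)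
  moreover have "inj_on Poly_Mapping.lookup ?A"
    by (rule inj_onI) (rule poly_mapping_eqI, simp)
  ultimately have "finite ?A"
    by (rule finite_imageD)
  then have "finite (?A \<times> ?A)"
    by (intro finite_cartesian_product)
  moreover have "{p. fst p + snd p = m} \<subseteq> ?A \<times> ?A"
  proof
    fix p assume "p \<in> {p. fst p + snd p = m}"
    then have "m = fst p + snd p" by simp
    then have "fst p \<in> ?A" "snd p \<in> ?A" by (simp_all only: mem_Collect_eq lookup_add) simp_all
    then show "p \<in> ?A \<times> ?A" by (simp only: mem_Times_iff)
  qed
  ultimately show ?thesis
    by (rule finite_subset[rotated])
qed

instantiation mps :: (comm_ring_1) comm_ring_1
begin

lift_definition zero_mps :: "'a mps" is "\<lambda>_. 0" .
lift_definition one_mps :: "'a mps" is "\<lambda>m. if m = 0 then 1 else 0" .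
lift_definition plus_mps :: "'a mps \<Rightarrow> 'a mps \<Rightarrow> 'a mps" is "\<lambda>f g m. f m + g m" .
lift_definition minus_mps :: "'a mps \<Rightarrow> 'a mps \<Rightarrow> 'a mps" is "\<lambda>f g m. f m - g m" .
lift_definition uminus_mps :: "'a mps \<Rightarrow> 'a mps" is "\<lambda>f m. - f m" .
lift_definition times_mps :: "'a mps \<Rightarrow> 'a mps \<Rightarrow> 'a mps" is
  "\<lambda>f g m. \<Sum>p | fst p + snd p = m. f (fst p) * g (snd p)" .

instance
proof
  fix f g h :: "'a mps"
  show "f * g * h = f * (g * h)"
  proof (transfer, rule ext)
    fix f g h :: "mono \<Rightarrow> 'a" and m :: mono
    let ?S = "\<lambda>m. {p :: mono \<times> mono. fst p + snd p = m}"
    have "(\<Sum>p\<in>?S m. (\<Sum>q\<in>?S (fst p). f (fst q) * g (snd q)) * h (snd p)) =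
        (\<Sum>p\<in>?S m. \<Sum>q\<in>?S (fst p). f (fst q) * g (snd q) * h (snd p))"
      by (simp only: sum_distrib_right)
    also have "\<dots> = (\<Sum>(p, q)\<in>Sigma (?S m) (\<lambda>p. ?S (fst p)). f (fst q) * g (snd q) * h (snd p))"
      by (rule sum.Sigma) (simp_all add: finite_mono_splits)
    also have "\<dots> = (\<Sum>(p, q)\<in>Sigma (?S m) (\<lambda>p. ?S (snd p)). f (fst p) * (g (fst q) * h (snd q)))"
      by (rule sum.reindex_bij_witness
          [of _ "\<lambda>(p, q). ((fst p + fst q, snd q), (fst p, fst q))"
                "\<lambda>(p, q). ((fst q, snd q + snd p), (snd q, snd p))"])
         (clarsimp simp: add.assoc mult.assoc)+
    also have "\<dots> = (\<Sum>p\<in>?S m. \<Sum>q\<in>?S (snd p). f (fst p) * (g (fst q) * h (snd q)))"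
      by (rule sum.Sigma[symmetric]) (simp_all add: finite_mono_splits)
    also have "\<dots> = (\<Sum>p\<in>?S m. f (fst p) * (\<Sum>q\<in>?S (snd p). g (fst q) * h (snd q)))"
      by (simp only: sum_distrib_left)
    finally show "(\<Sum>p\<in>?S m. (\<Sum>q\<in>?S (fst p). f (fst q) * g (snd q)) * h (snd p)) =
        (\<Sum>p\<in>?S m. f (fst p) * (\<Sum>q\<in>?S (snd p). g (fst q) * h (snd q)))" .
  qed
  show "f * g = g * f"
  proof (transfer, rule ext)
    fix f g :: "mono \<Rightarrow> 'a" and m :: mono
    show "(\<Sum>p | fst p + snd p = m. f (fst p) * g (snd p)) =
        (\<Sum>p | fst p + snd p = m. g (fst p) * f (snd p))"
      by (rule sum.reindex_bij_witness[of _ prod.swap prod.swap]) (auto simp: add.commute mult.commute)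
  qed
  show "1 * f = f"
  proof (transfer, rule ext)
    fix f :: "mono \<Rightarrow> 'a" and m :: mono
    have "(\<Sum>p | fst p + snd p = m. (if fst p = 0 then 1 else 0) * f (snd p)) =
        (\<Sum>p\<in>{(0 :: mono, m)}. (if fst p = 0 then 1 else 0) * f (snd p))"
    proof (rule sum.mono_neutral_right[OF finite_mono_splits], simp, rule ballI)
      fix p :: "mono \<times> mono" assume "p \<in> {p. fst p + snd p = m} - {(0, m)}"
      then have "fst p \<noteq> 0" by (cases p) auto
      then show "(if fst p = 0 then 1 else 0) * f (snd p) = 0" by simp
    qed
    then show "(\<Sum>p | fst p + snd p = m. (if fst p = 0 then 1 else 0) * f (snd p)) = f m"
      by simp
  qed
  show "(f + g) * h = f * h + g * h"
    by transfer (simp add: algebra_simps sum.distrib)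
  show "(0 :: 'a mps) \<noteq> 1"
  proof transfer
    show "(\<lambda>_ :: mono. 0 :: 'a) \<noteq> (\<lambda>m. if m = 0 then 1 else 0)"
      by (auto dest: fun_cong[of _ _ 0])
  qed
  show "f + g + h = f + (g + h)" by transfer (simp add: add.assoc)
  show "f + g = g + f" by transfer (simp add: add.commute)
  show "0 + f = f" by transfer simp
  show "- f + f = 0" by transfer simp
  show "f - g = f + - g" by transfer simp
qed

end

lift_definition mps_scale :: "'a::comm_ring_1 \<Rightarrow> 'a mps \<Rightarrow> 'a mps" is
  "\<lambda>c f m. c * f m" .

lift_definition power_sum :: "nat \<Rightarrow> 'a::comm_ring_1 mps" is
  "\<lambda>d m. if \<exists>i. m = Poly_Mapping.single i d then 1 else 0" .

definition partitions :: "nat \<Rightarrow> nat list set" where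
  "partitions n = {la. sorted_wrt (\<ge>) la \<and> (\<forall>x\<in>set la. 0 < x) \<and> sum_list la = n}"

definition cells :: "nat list \<Rightarrow> (nat \<times> nat) set" where
  "cells la = {(i, j). i < length la \<and> j < la ! i}"

text \<open>
  Fillings are extensional, so that distinct members of \<open>ssyt la\<close> differ on a cell of the diagram.
\<close>

definition ssyt :: "nat list \<Rightarrow> (nat \<times> nat \<Rightarrow> nat) set" where
  "ssyt la = {T \<in> extensional (cells la).
     (\<forall>i j j'. j < j' \<and> (i, j) \<in> cells la \<and> (i, j') \<in> cells la \<longrightarrow> T (i, j) \<le> T (i, j')) \<and>
     (\<forall>i i' j. i < i' \<and> (i, j) \<in> cells la \<and> (i', j) \<in> cells la \<longrightarrow> T (i, j) < T (i', j))}"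

definition content :: "nat list \<Rightarrow> (nat \<times> nat \<Rightarrow> nat) \<Rightarrow> mono" where
  "content la T = (\<Sum>c\<in>cells la. Poly_Mapping.single (T c) 1)"

lift_definition schur :: "nat list \<Rightarrow> 'a::comm_ring_1 mps" is
  "\<lambda>la m. of_nat (card {T \<in> ssyt la. content la T = m})" .

definition schur_positive :: "nat \<Rightarrow> 'a::comm_ring_1 mps \<Rightarrow> bool" where
  "schur_positive n f \<longleftrightarrow>
     (\<exists>c :: nat list \<Rightarrow> nat. f = (\<Sum>la\<in>partitions n. mps_scale (of_nat (c la)) (schur la)))"

text \<open>
  The power sum \<open>p\<close> indexed by the cycle type of \<open>s\<close>: fixed points in \<open>{1..n}\<close> are singleton orbits.
\<close>

definition cycle_power_sum :: "nat \<Rightarrow> (nat \<Rightarrow> nat) \<Rightarrow> complex mps" where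
  "cycle_power_sum n s = (\<Prod>B\<in>orbit s ` {1..n}. power_sum (card B))"

definition frobenius_ch :: "nat \<Rightarrow> ((nat \<Rightarrow> nat) \<Rightarrow> complex) \<Rightarrow> complex mps" where
  "frobenius_ch n chi =
     mps_scale (1 / fact n) (\<Sum>s\<in>carrier (sym_group n). mps_scale (chi s) (cycle_power_sum n s))"

text \<open>
  The representation of \<open>G\<close> induced from a one-dimensional character \<open>chi\<close> of a subgroup \<open>H\<close>,
  as a matrix representation with rows and columns indexed by the left cosets of \<open>H\<close>:
  for a transversal \<open>t\<close>, the entry of \<open>g\<close> at \<open>(A, B)\<close> is \<open>chi (t\<^sub>A\<inverse> g t\<^sub>B)\<close>, with \<open>chi\<close> extended by
  zero outside \<open>H\<close>.
\<close>

definition coset_rep :: "'a set \<Rightarrow> 'a" where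
  "coset_rep A = (SOME t. t \<in> A)"

definition induced_rep ::
  "('a, 'b) monoid_scheme \<Rightarrow> 'a set \<Rightarrow> ('a \<Rightarrow> complex) \<Rightarrow> 'a \<Rightarrow> 'a set \<Rightarrow> 'a set \<Rightarrow> complex" where
  "induced_rep G H chi g A B =
     (let h = inv\<^bsub>G\<^esub> (coset_rep A) \<otimes>\<^bsub>G\<^esub> g \<otimes>\<^bsub>G\<^esub> coset_rep B
      in if h \<in> H then chi h else 0)"

definition induced_character ::
  "('a, 'b) monoid_scheme \<Rightarrow> 'a set \<Rightarrow> ('a \<Rightarrow> complex) \<Rightarrow> 'a \<Rightarrow> complex" where
  "induced_character G H chi g = (\<Sum>A\<in>lcosets\<^bsub>G\<^esub> H. induced_rep G H chi g A A)"

definition long_cycle :: "nat \<Rightarrow> nat \<Rightarrow> nat" where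
  "long_cycle n = cycle_of_list [1..<Suc n]"

definition cyclic_subgroup :: "nat \<Rightarrow> (nat \<Rightarrow> nat) set" where
  "cyclic_subgroup n = generate (sym_group n) {long_cycle n}"

definition cyclic_character :: "nat \<Rightarrow> nat \<Rightarrow> (nat \<Rightarrow> nat) \<Rightarrow> complex" where
  "cyclic_character n r s =
     exp (2 * of_real pi * \<i> * of_nat r / of_nat n) ^ (LEAST k. long_cycle n ^^ k = s)"

lemma long_cycle_funpow_1:
  assumes "n \<ge> 1"
  shows "(long_cycle n ^^ k) 1 = Suc (k mod n)"
proof -
  have "cycle [1..<Suc n]" by simp
  then have "map (long_cycle n ^^ k) [1..<Suc n] = rotate k [1..<Suc n]"
    unfolding long_cycle_def by (rule cyclic_rotation)
  then have "map (long_cycle n ^^ k) [1..<Suc n] ! 0 = rotate k [1..<Suc n] ! 0"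
    by (rule arg_cong)
  with assms show ?thesis
    by (simp add: nth_rotate del: upt_Suc)
qed

text \<open>
  The choice of exponent is immaterial: this is the one-dimensional character of the cyclic
  subgroup with value \<open>exp (2 pi i r / n)\<close> at the long cycle.
\<close>

lemma cyclic_character_funpow:
  assumes "n \<ge> 1"
  shows "cyclic_character n r (long_cycle n ^^ k) = exp (2 * of_real pi * \<i> * of_nat r / of_nat n) ^ k"
proof -
  define z where "z = exp (2 * of_real pi * \<i> * of_nat r / (of_nat n :: complex))"
  define l where "l = (LEAST l. long_cycle n ^^ l = long_cycle n ^^ k)"
  have "z ^ n = exp (of_nat n * (2 * of_real pi * \<i> * of_nat r / (of_nat n :: complex)))"
    unfolding z_def by (rule exp_of_nat_mult[symmetric])
  also have "of_nat n * (2 * of_real pi * \<i> * of_nat r / (of_nat n :: complex)) =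
      of_nat r * (2 * of_real pi * \<i>)"
    using assms by simp
  also have "exp \<dots> = exp (2 * of_real pi * \<i>) ^ r"
    by (rule exp_of_nat_mult)
  finally have "z ^ n = 1" by simp
  then have mod: "z ^ j = z ^ (j mod n)" for j
    using power_add[of z "n * (j div n)" "j mod n"] by (simp add: power_mult)
  have "long_cycle n ^^ l = long_cycle n ^^ k"
    unfolding l_def by (rule LeastI) (rule refl)
  then have "l mod n = k mod n"
    using long_cycle_funpow_1[OF assms] by (metis nat.inject)
  then have "z ^ l = z ^ k"
    using mod by metis
  then show ?thesis
    unfolding cyclic_character_def z_def l_def .
qed

definition ell :: "nat \<Rightarrow> nat \<Rightarrow> complex mps" where
  "ell n r = frobenius_ch n
     (induced_character (sym_group n) (cyclic_subgroup n) (cyclic_character n r))"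

definition ramanujan_sum :: "nat \<Rightarrow> nat \<Rightarrow> complex" where
  "ramanujan_sum d r =
     (\<Sum>m | 1 \<le> m \<and> m \<le> d \<and> coprime m d. exp (2 * of_real pi * \<i> * of_nat m * of_nat r / of_nat d))"

definition ramanujan_coeff :: "nat \<Rightarrow> nat \<Rightarrow> complex" where
  "ramanujan_coeff k n = (\<Sum>d | d dvd n. ramanujan_sum k (n div d))"

end

theory Submission
  imports
    Defs
    "HOL-Number_Theory.Totient"
    "HOL-Combinatorics.Multiset_Permutations"
    "HOL-Computational_Algebra.Polynomial"
begin

text \<open>
  Write \<open>\<omega> = exp (2 pi i / n)\<close>. Frobenius reciprocity for the cyclic subgroup gives
  \<open>n \<ell>^(r) = \<Sum> j = 1..n. \<omega>^(r j) p_(n / gcd j n)^(gcd j n)\<close>, because the \<open>j\<close>-th power of the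
  long cycle consists of \<open>gcd j n\<close> cycles of equal length. Sorting the summands by the order
  \<open>d = n / gcd j n\<close> turns the roots of unity into Ramanujan sums:
  \<open>n \<ell>^(r) = \<Sum> d | n. c_d(r) p_d^(n / d)\<close>. The expansion of the sum of the
  \<open>p_d^(n / d)\<close> therefore amounts to the orthogonality relation
  \<open>\<Sum> k | n. a_k(n) c_e(n / k) = n\<close> for all \<open>e | n\<close>. It holds because
  \<open>\<Sum> k | e. c_k(r)\<close> is \<open>e\<close> if \<open>e | r\<close> and \<open>0\<close> otherwise, and because a function on the
  divisors of \<open>n\<close> is determined by its divisor sums.

  Schur positivity has two ingredients. The coefficients \<open>a_k(n)\<close> are nonnegative integers:
  their divisor sums are \<open>\<Sum> k | e. a_k(n) = e \<tau>(n / e)\<close> with \<open>\<tau>\<close> counting divisors, and the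
  multiplicative function with these divisor sums is visibly nonnegative at prime powers.
  Each \<open>\<ell>^(r)\<close> is Schur positive, with an explicit combinatorial expansion. Let \<open>M\<close> be a
  multiset of \<open>n\<close> letters. By MacMahon's theorem the generating function of the major index
  over the words of content \<open>M\<close> is a \<open>q\<close>-multinomial coefficient, and its value at a primitive
  \<open>d\<close>-th root of unity is the coefficient of \<open>p_d^(n / d)\<close> at the monomial of \<open>M\<close>. Averaging over
  the \<open>n\<close>-th roots of unity shows that the coefficient of \<open>\<ell>^(r)\<close> at this monomial is the number of
  words of content \<open>M\<close> whose major index is congruent to \<open>-r\<close> modulo \<open>n\<close>. The
  Robinson-Schensted correspondence by row insertion carries a word to a semistandard tableau
  of the same content and a recording word with the same descents, hence the same major index,
  and the two range independently over all pairs of equal shape. So the coefficient of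
  the Schur function of \<open>\<lambda>\<close> in \<open>\<ell>^(r)\<close> is the number of recording words of shape \<open>\<lambda>\<close> with major
  index congruent to \<open>-r\<close>.

  Words are stored from right to left throughout, so that appending a letter to a
  word is the list constructor and both inductions above are structural.
\<close>

section \<open>Ramanujan sums\<close>

definition unit_root :: "nat \<Rightarrow> complex" where
  "unit_root n = exp (2 * of_real pi * \<i> / of_nat n)"

lemma unit_root_power: "unit_root n ^ j = exp (2 * of_real pi * \<i> * of_nat j / of_nat n)"
  unfolding unit_root_def by (simp add: exp_of_nat_mult[symmetric] mult_ac)

lemma unit_root_power_eq_1_iff:
  assumes "n \<ge> 1"
  shows "unit_root n ^ j = 1 \<longleftrightarrow> n dvd j"
proof
  assume "n dvd j"
  then obtain q where "j = n * q" by blast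
  moreover have "unit_root n ^ n = 1"
    using assms by (simp add: unit_root_power)
  ultimately show "unit_root n ^ j = 1" by (simp add: power_mult)
next
  have cis: "unit_root n ^ k = cis (2 * pi * real k / real n)" for k
    unfolding unit_root_power by (simp add: cis_conv_exp mult_ac)
  assume "unit_root n ^ j = 1"
  moreover have "unit_root n ^ n = 1" using assms by (simp add: unit_root_power)
  then have "unit_root n ^ j = unit_root n ^ (j mod n)"
    using power_add[of "unit_root n" "n * (j div n)" "j mod n"] by (simp add: power_mult)
  ultimately have "cis (2 * pi * real (j mod n) / real n) = cis (2 * pi * real 0 / real n)"
    using cis[of "j mod n"] by simp
  then have "j mod n = 0"
    using assms inj_onD[OF bij_betw_imp_inj_on[OF bij_betw_roots_unity[of n]], of "j mod n" 0] by simp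
  then show "n dvd j" by auto
qed

lemma unit_root_dvd:
  assumes "n \<ge> 1" "d dvd n"
  shows "unit_root n ^ (n div d) = unit_root d"
proof -
  from assms obtain q where n: "n = d * q" by blast
  with assms have "d > 0" "q > 0" by auto
  then show ?thesis unfolding unit_root_power n by (simp add: unit_root_def)
qed

lemma sum_unit_root_powers:
  assumes "n \<ge> 1"
  shows "(\<Sum>j=1..n. unit_root n ^ (r * j)) = (if n dvd r then of_nat n else 0)"
proof -
  define z where "z = unit_root n ^ r"
  have zn: "z ^ n = 1" using assms by (simp add: z_def power_mult[symmetric] unit_root_power_eq_1_iff)
  have "(\<Sum>j=1..n. unit_root n ^ (r * j)) = z * (\<Sum>j<n. z ^ j)"
    using sum.atLeast1_atMost_eq[of "\<lambda>j. z ^ j" n] by (simp add: z_def power_mult sum_distrib_left)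
  also have "\<dots> = (if z = 1 then of_nat n else 0)"
    by (simp add: geometric_sum zn)
  also have "z = 1 \<longleftrightarrow> n dvd r" unfolding z_def using assms by (rule unit_root_power_eq_1_iff)
  finally show ?thesis .
qed

text \<open>
  The numbers \<open>j\<close> in \<open>{1..n}\<close> with \<open>n div gcd j n = d\<close> are the multiples \<open>m * (n div d)\<close> with
  \<open>m\<close> prime to \<open>d\<close>, and for them \<open>unit_root n ^ j = unit_root d ^ m\<close> runs through the primitive
  \<open>d\<close>-th roots of unity that are summed in \<open>ramanujan_sum d r\<close>.
\<close>

lemma sum_group_by_order:
  fixes f :: "nat \<Rightarrow> complex"
  assumes n: "n \<ge> 1"
  shows "(\<Sum>j=1..n. f (n div gcd j n) * unit_root n ^ (r * j)) =
         (\<Sum>d | d dvd n. f d * ramanujan_sum d r)"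
proof -
  have fin: "finite {d. d dvd n}" using n by simp
  have "(\<Sum>j=1..n. f (n div gcd j n) * unit_root n ^ (r * j)) =
      (\<Sum>d | d dvd n. \<Sum>j | j \<in> {1..n} \<and> n div gcd j n = d. f (n div gcd j n) * unit_root n ^ (r * j))"
    by (rule sum.group[symmetric]) (use fin in \<open>auto simp: div_dvd_iff_mult\<close>)
  also have "\<dots> = (\<Sum>d | d dvd n. f d * ramanujan_sum d r)"
  proof (rule sum.cong)
    fix d assume "d \<in> {d. d dvd n}"
    then obtain q where q: "n = d * q" by blast
    with n have pos: "d > 0" "q > 0" by auto
    have "n div gcd j n = d \<longleftrightarrow> gcd j n = q" for j
    proof -
      obtain t where t: "n = gcd j n * t" using gcd_dvd2 by blast
      have "gcd j n > 0" using n by simp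
      then have "n div gcd j n = t" using t by (metis nonzero_mult_div_cancel_left neq0_conv)
      then show ?thesis using t q pos by auto
    qed
    then have "{j. j \<in> {1..n} \<and> n div gcd j n = d} = {j \<in> {0<..n}. gcd j n = q}" by auto
    moreover have "bij_betw (\<lambda>m. m * q) (totatives d) {j \<in> {0<..n}. gcd j n = q}"
      using bij_betw_totatives_gcd_eq[of q n] n q pos by simp
    ultimately have "(\<Sum>j | j \<in> {1..n} \<and> n div gcd j n = d. f (n div gcd j n) * unit_root n ^ (r * j)) =
        (\<Sum>m\<in>totatives d. f (n div gcd (m * q) n) * unit_root n ^ (r * (m * q)))"
      by (simp only: sum.reindex_bij_betw[where g = "\<lambda>j. f (n div gcd j n) * unit_root n ^ (r * j)"])
    also have "\<dots> = (\<Sum>m | 1 \<le> m \<and> m \<le> d \<and> coprime m d. f d * unit_root d ^ (r * m))"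
    proof (rule sum.cong)
      fix m assume "m \<in> {m. 1 \<le> m \<and> m \<le> d \<and> coprime m d}"
      then have "gcd (m * q) n = q" unfolding q by (simp add: gcd_mult_right gcd.commute coprime_iff_gcd_eq_1)
      moreover have "unit_root n ^ (r * (m * q)) = unit_root d ^ (r * m)"
      proof -
        have "unit_root n ^ (r * (m * q)) = (unit_root n ^ q) ^ (r * m)"
          by (simp add: power_mult[symmetric] mult_ac)
        then show ?thesis using unit_root_dvd[of n d] n q pos by simp
      qed
      ultimately show "f (n div gcd (m * q) n) * unit_root n ^ (r * (m * q)) = f d * unit_root d ^ (r * m)"
        using q pos by simp
    qed (auto simp: in_totatives_iff)
    also have "\<dots> = f d * ramanujan_sum d r"
      unfolding ramanujan_sum_def sum_distrib_left unit_root_power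
      by (intro sum.cong refl) (simp add: mult_ac)
    finally show "(\<Sum>j | j \<in> {1..n} \<and> n div gcd j n = d. f (n div gcd j n) * unit_root n ^ (r * j)) =
      f d * ramanujan_sum d r" .
  qed simp
  finally show ?thesis .
qed

lemma divisor_sum_ramanujan_sum:
  assumes "n \<ge> 1"
  shows "(\<Sum>d | d dvd n. ramanujan_sum d r) = (if n dvd r then of_nat n else 0)"
  using sum_group_by_order[OF assms, of "\<lambda>_. 1" r] sum_unit_root_powers[OF assms, of r] by simp

text \<open>
  This replaces Moebius inversion: identities for Ramanujan sums are proved below after
  summation over divisors, where they become elementary.
\<close>

lemma divisor_sums_unique:
  fixes f g :: "nat \<Rightarrow> 'a::ab_group_add"
  assumes n: "n \<ge> 1" and eq: "\<And>e. e dvd n \<Longrightarrow> (\<Sum>k | k dvd e. f k) = (\<Sum>k | k dvd e. g k)"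
    and "e dvd n"
  shows "f e = g e"
  using assms(3)
proof (induction e rule: less_induct)
  case (less e)
  have e: "e > 0" using less.prems n by (auto intro: Nat.gr0I)
  have split: "(\<Sum>k | k dvd e. h k) = h e + (\<Sum>k | k dvd e \<and> k \<noteq> e. h k)" for h :: "nat \<Rightarrow> 'a"
  proof -
    have "{k. k dvd e} = insert e {k. k dvd e \<and> k \<noteq> e}" by auto
    moreover have "finite {k. k dvd e \<and> k \<noteq> e}" using e by simp
    ultimately show ?thesis by simp
  qed
  have "(\<Sum>k | k dvd e \<and> k \<noteq> e. f k) = (\<Sum>k | k dvd e \<and> k \<noteq> e. g k)"
    using e less.prems by (intro sum.cong refl less.IH) (auto simp: dvd_imp_le le_neq_implies_less intro: dvd_trans)
  with eq[OF less.prems] show ?case by (simp add: split)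
qed

lemma complementary_divisors:
  fixes e q :: nat
  assumes "e > 0" "q > 0"
  shows "{k. k dvd e * q \<and> e dvd e * q div k} = {k. k dvd q}"
proof (intro equalityI subsetI CollectI)
  fix k assume "k \<in> {k. k dvd e * q \<and> e dvd e * q div k}"
  then obtain t s where ts: "e * q = k * t" "e * q div k = e * s" by (elim CollectE conjE dvdE)
  then have "k > 0" using assms by (intro Nat.gr0I) auto
  with ts have "e * q = e * (k * s)" by (metis mult.left_commute nonzero_mult_div_cancel_left not_gr_zero)
  with assms have "q = k * s" by simp
  then show "k dvd q" by simp
next
  fix k assume "k \<in> {k. k dvd q}"
  then obtain s where "q = k * s" by blast
  with assms show "k dvd e * q \<and> e dvd e * q div k" by simp
qed

lemma divisor_sum_ramanujan_coeff:
  assumes n: "n \<ge> 1" and e: "e dvd n"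
  shows "(\<Sum>k | k dvd e. ramanujan_coeff k n) = of_nat (e * card {d. d dvd n div e})"
proof -
  from e obtain q where q: "n = e * q" by blast
  with n have e1: "e \<ge> 1" and pos: "e > 0" "q > 0" by (auto intro: Nat.gr0I simp: Suc_le_eq)
  have "(\<Sum>k | k dvd e. ramanujan_coeff k n) =
      (\<Sum>d | d dvd n. \<Sum>k | k dvd e. ramanujan_sum k (n div d))"
    unfolding ramanujan_coeff_def by (rule sum.swap)
  also have "\<dots> = (\<Sum>d | d dvd n. if e dvd n div d then of_nat e else 0)"
    by (simp add: divisor_sum_ramanujan_sum[OF e1])
  also have "\<dots> = (\<Sum>d | d dvd n \<and> e dvd n div d. of_nat e)"
    using n by (subst sum.inter_filter[symmetric]) simp_all
  also have "{d. d dvd n \<and> e dvd n div d} = {d. d dvd n div e}"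
    using complementary_divisors[OF pos] q pos by simp
  finally show ?thesis by (simp add: mult.commute)
qed

text \<open>
  Summation over the divisors of \<open>e\<close> replaces the Ramanujan sums by an indicator of divisibility
  and leaves \<open>n\<close> times the number of divisors of \<open>e\<close> on both sides.
\<close>

lemma ramanujan_coeff_orthogonality:
  assumes n: "n \<ge> 1" and e: "e dvd n"
  shows "(\<Sum>k | k dvd n. ramanujan_coeff k n * ramanujan_sum e (n div k)) = of_nat n"
proof (rule divisor_sums_unique[OF n _ e])
  fix e assume e: "e dvd n"
  then obtain q where q: "n = e * q" by blast
  with n have pos: "e \<ge> 1" "q \<ge> 1" by (auto simp: Suc_le_eq intro: Nat.gr0I)
  have "(\<Sum>d | d dvd e. \<Sum>k | k dvd n. ramanujan_coeff k n * ramanujan_sum d (n div k)) =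
      (\<Sum>k | k dvd n. ramanujan_coeff k n * (\<Sum>d | d dvd e. ramanujan_sum d (n div k)))"
    unfolding sum_distrib_left by (rule sum.swap)
  also have "\<dots> = (\<Sum>k | k dvd n. if e dvd n div k then ramanujan_coeff k n * of_nat e else 0)"
    by (intro sum.cong refl) (simp add: divisor_sum_ramanujan_sum[OF pos(1)])
  also have "\<dots> = (\<Sum>k | k dvd n \<and> e dvd n div k. ramanujan_coeff k n * of_nat e)"
    using n by (subst sum.inter_filter[symmetric]) simp_all
  also have "{k. k dvd n \<and> e dvd n div k} = {k. k dvd q}"
    using complementary_divisors[of e q] q pos by simp
  also have "(\<Sum>k | k dvd q. ramanujan_coeff k n * of_nat e) = of_nat e * (\<Sum>k | k dvd q. ramanujan_coeff k n)"
    by (simp add: sum_distrib_left mult.commute)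
  also have "\<dots> = of_nat e * of_nat (q * card {d. d dvd n div q})"
    using q by (subst divisor_sum_ramanujan_coeff[OF n]) auto
  also have "\<dots> = (\<Sum>d | d dvd e. of_nat n)" using q pos by simp
  finally show "(\<Sum>d | d dvd e. \<Sum>k | k dvd n. ramanujan_coeff k n * ramanujan_sum d (n div k)) =
    (\<Sum>d | d dvd e. of_nat n)" .
qed

lemma divisor_sum_prime_power_mult:
  fixes p e :: nat
  assumes p: "prime p" and e: "e > 0" "\<not> p dvd e"
  shows "(\<Sum>k | k dvd p ^ i * e. F k) = (\<Sum>j\<le>i. \<Sum>k | k dvd e. F (p ^ j * k))"
proof -
  have "(\<Sum>j\<le>i. \<Sum>k | k dvd e. F (p ^ j * k)) = (\<Sum>(j, k)\<in>{..i} \<times> {k. k dvd e}. F (p ^ j * k))"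
    by (rule sum.cartesian_product)
  also have "\<dots> = (\<Sum>k | k dvd p ^ i * e. F k)"
  proof -
    have "bij_betw (\<lambda>(j, k). p ^ j * k) ({..i} \<times> {k. k dvd e}) {k. k dvd p ^ i * e}"
      unfolding bij_betw_def
    proof
      have mult: "multiplicity p (p ^ j * k) = j" if "k dvd e" for j k
        using that p e by (intro multiplicity_eqI) (auto simp: prime_dvd_mult_iff dest: dvd_trans)
      show "inj_on (\<lambda>(j, k). p ^ j * k) ({..i} \<times> {k. k dvd e})"
      proof (rule inj_onI, clarify)
        fix j k j' k' assume *: "k dvd e" "k' dvd e" "p ^ j * k = p ^ j' * k'"
        then have "j = j'" using mult by metis
        with * p show "j = j' \<and> k = k'" by (simp add: prime_gt_0_nat)
      qed
      show "(\<lambda>(j, k). p ^ j * k) ` ({..i} \<times> {k. k dvd e}) = {k. k dvd p ^ i * e}"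
      proof (intro equalityI subsetI)
        fix k assume "k \<in> {k. k dvd p ^ i * e}"
        then obtain a b where ab: "k = a * b" "a dvd p ^ i" "b dvd e"
          using division_decomp[of k "p ^ i" e] by blast
        then obtain j where "j \<le> i" "a = p ^ j" using p by (auto simp: divides_primepow_nat)
        with ab show "k \<in> (\<lambda>(j, k). p ^ j * k) ` ({..i} \<times> {k. k dvd e})" by auto
      qed (auto intro: mult_dvd_mono le_imp_power_dvd)
    qed
    from sum.reindex_bij_betw[OF this, of F] show ?thesis by (simp add: case_prod_beta)
  qed
  finally show ?thesis by (rule sym)
qed

text \<open>
  Split off the full power \<open>p ^ m\<close> of a prime from \<open>n\<close>. At \<open>p ^ j\<close>, \<open>j > 0\<close>, the wanted function is the
  difference \<open>p ^ j * (m - j + 1) - p ^ (j - 1) * (m - j + 2)\<close>, whose sums telescope; it is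
  nonnegative because \<open>m - j + 2 \<le> 2 * (m - j + 1)\<close> and \<open>p \<ge> 2\<close>. The function for \<open>n\<close> is the
  product of this one and the one for the part of \<open>n\<close> prime to \<open>p\<close>.
\<close>

lemma ex_nat_with_divisor_sums:
  "n \<ge> 1 \<Longrightarrow> \<exists>a :: nat \<Rightarrow> nat. \<forall>e. e dvd n \<longrightarrow> (\<Sum>k | k dvd e. a k) = e * card {d. d dvd n div e}"
proof (induction n rule: less_induct)
  case (less n)
  show ?case
  proof (cases "n = 1")
    case True
    then show ?thesis by (intro exI[of _ "\<lambda>_. 1"]) simp
  next
    case False
    then obtain p where p: "prime p" "p dvd n" using prime_factor_nat by blast
    define m where "m = multiplicity p n"
    obtain n' where n': "n = p ^ m * n'" "\<not> p dvd n'"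
      unfolding m_def using p less.prems by (metis multiplicity_decompose' not_prime_unit not_one_le_zero)
    have "m > 0" using n' p by (cases m) auto
    have p2: "p \<ge> 2" using p by (simp add: prime_ge_2_nat)
    have n'0: "n' > 0" using n' less.prems by (auto intro: Nat.gr0I)
    have "1 < p ^ m" using p2 \<open>m > 0\<close> by (metis One_nat_def Suc_1 Suc_le_lessD one_less_power)
    then have "n' < n" using n'(1) n'0 by simp
    from less.IH[OF this] n'0 obtain b where
      b: "\<And>e. e dvd n' \<Longrightarrow> (\<Sum>k | k dvd e. b k) = e * card {d. d dvd n' div e}" by auto
    define \<alpha> where "\<alpha> j = (case j of 0 \<Rightarrow> m + 1
      | Suc i \<Rightarrow> p ^ Suc i * (m - Suc i + 1) - p ^ i * (m - i + 1))" for j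
    have \<alpha>: "(\<Sum>j\<le>i. \<alpha> j) = p ^ i * (m - i + 1)" if "i \<le> m" for i
      using that
    proof (induction i)
      case (Suc i)
      have "m - i + 1 \<le> 2 * (m - Suc i + 1)" using Suc.prems by simp
      also have "\<dots> \<le> p * (m - Suc i + 1)" using p2 by (rule mult_right_mono) simp
      finally have "p ^ i * (m - i + 1) \<le> p ^ i * (p * (m - Suc i + 1))" by (rule mult_left_mono) simp
      moreover have "p ^ i * (p * (m - Suc i + 1)) = p ^ Suc i * (m - Suc i + 1)"
        by (simp add: algebra_simps)
      moreover have "(\<Sum>j\<le>Suc i. \<alpha> j) =
          p ^ i * (m - i + 1) + (p ^ Suc i * (m - Suc i + 1) - p ^ i * (m - i + 1))"
        using Suc by (simp only: sum.atMost_Suc \<alpha>_def nat.case)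
      ultimately show ?case by simp
    qed (simp add: \<alpha>_def)
    define a where "a k = \<alpha> (multiplicity p k) * b (k div p ^ multiplicity p k)" for k
    have a: "a (p ^ j * k) = \<alpha> j * b k" if "k dvd n'" for j k
    proof -
      have "multiplicity p (p ^ j * k) = j"
        using that p n' n'0 by (intro multiplicity_eqI) (auto simp: prime_dvd_mult_iff dest: dvd_trans)
      then show ?thesis using p2 by (simp add: a_def)
    qed
    have card_div: "card {d. d dvd p ^ i * e} = (i + 1) * card {d. d dvd e}" if "e > 0" "\<not> p dvd e" for i e
      using divisor_sum_prime_power_mult[OF p(1) that, of "\<lambda>_. 1 :: nat" i] by simp
    show ?thesis
    proof (intro exI[of _ a] allI impI)
      fix e assume "e dvd n"
      then obtain u e' where "e = u * e'" "u dvd p ^ m" and e': "e' dvd n'"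
        using division_decomp[of e "p ^ m" n'] n' by blast
      then obtain i where e: "e = p ^ i * e'" and i: "i \<le> m" using p(1) by (auto simp: divides_primepow_nat)
      have e'0: "e' > 0" "\<not> p dvd e'"
        using dvd_pos_nat[OF n'0 e'] dvd_trans[OF _ e', of p] n'(2) by blast+
      have "(\<Sum>k | k dvd e. a k) = (\<Sum>j\<le>i. \<Sum>k | k dvd e'. a (p ^ j * k))"
        unfolding e by (rule divisor_sum_prime_power_mult[OF p(1) e'0])
      also have "\<dots> = (\<Sum>j\<le>i. \<Sum>k | k dvd e'. \<alpha> j * b k)"
        using e' by (intro sum.cong refl a) (auto dest: dvd_trans)
      also have "\<dots> = (\<Sum>j\<le>i. \<alpha> j) * (\<Sum>k | k dvd e'. b k)"
        by (simp add: sum_product)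
      also have "\<dots> = p ^ i * (m - i + 1) * (e' * card {d. d dvd n' div e'})"
        using \<alpha>[OF i] b[OF e'] by simp
      finally have sum: "(\<Sum>k | k dvd e. a k) = p ^ i * (m - i + 1) * (e' * card {d. d dvd n' div e'})" .
      have "n div e = p ^ (m - i) * (n' div e')"
      proof -
        obtain q where q: "n' = e' * q" using e' by blast
        have "p ^ m = p ^ i * p ^ (m - i)" using i by (simp add: power_add[symmetric])
        then have "n = e * (p ^ (m - i) * q)" using q n' e by (simp add: mult_ac)
        then show ?thesis using e q e'0 p2 by simp
      qed
      moreover have "n' div e' > 0" "\<not> p dvd n' div e'"
      proof -
        show "n' div e' > 0" using e' n'0 e'0 by (simp add: div_greater_zero_iff dvd_imp_le)
        have "n' div e' dvd n'" using e' by (metis dvd_div_mult_self dvd_triv_left)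
        then show "\<not> p dvd n' div e'" using n'(2) dvd_trans by blast
      qed
      ultimately have "card {d. d dvd n div e} = (m - i + 1) * card {d. d dvd n' div e'}"
        by (simp add: card_div)
      with sum show "(\<Sum>k | k dvd e. a k) = e * card {d. d dvd n div e}"
        by (simp only: e mult_ac)
    qed
  qed
qed

lemma ramanujan_coeff_nat:
  assumes n: "n \<ge> 1"
  obtains a :: "nat \<Rightarrow> nat" where "\<And>k. k dvd n \<Longrightarrow> ramanujan_coeff k n = of_nat (a k)"
proof -
  obtain a :: "nat \<Rightarrow> nat" where
    a: "\<And>e. e dvd n \<Longrightarrow> (\<Sum>k | k dvd e. a k) = e * card {d. d dvd n div e}"
    using ex_nat_with_divisor_sums[OF n] by blast
  have "ramanujan_coeff k n = of_nat (a k)" if "k dvd n" for k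
    using n _ that
    by (rule divisor_sums_unique) (simp add: a divisor_sum_ramanujan_coeff[OF n] flip: of_nat_sum of_nat_mult)
  then show ?thesis by (rule that)
qed

section \<open>The characters of the cyclic group and their induction\<close>

text \<open>
  Frobenius reciprocity, multiplied by both group orders: each coset contributes a sum over a
  conjugate of \<open>H\<close>, which conjugation turns into the sum over \<open>H\<close> because \<open>f\<close> is a class function.
\<close>

lemma (in group) sum_induced_character:
  fixes f chi :: "'a \<Rightarrow> complex"
  assumes fin: "finite (carrier G)" and H: "subgroup H G"
    and f: "\<And>s t. s \<in> carrier G \<Longrightarrow> t \<in> carrier G \<Longrightarrow> f (inv t \<otimes> s \<otimes> t) = f s"
  shows "of_nat (card H) * (\<Sum>s\<in>carrier G. induced_character G H chi s * f s) =
         of_nat (Coset.order G) * (\<Sum>h\<in>H. chi h * f h)"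
proof -
  let ?ext = "\<lambda>h. (if h \<in> H then chi h else 0) * f h"
  have HG: "H \<subseteq> carrier G" using H by (rule subgroup.subset)
  have coset: "(\<Sum>s\<in>carrier G. induced_rep G H chi s A A * f s) = (\<Sum>h\<in>H. chi h * f h)"
    if A: "A \<in> lcosets H" for A
  proof -
    obtain a where a: "a \<in> carrier G" "A = a <# H" using A by (auto simp: LCOSETS_def)
    then have "a \<in> A" using H by (simp add: lcos_self)
    then have "coset_rep A \<in> A" unfolding coset_rep_def by (rule someI)
    then have t: "coset_rep A \<in> carrier G"
      using a HG by (auto simp: l_coset_def)
    let ?t = "coset_rep A"
    \<comment> \<open>conjugation by \<open>t\<close> is a bijection of the group\<close>
    have cancel: "?t \<otimes> (inv ?t \<otimes> y) = y" "inv ?t \<otimes> (?t \<otimes> y) = y" if "y \<in> carrier G" for y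
      using t that by (simp_all add: m_assoc[symmetric])
    have "(\<Sum>s\<in>carrier G. induced_rep G H chi s A A * f s) =
        (\<Sum>s\<in>carrier G. ?ext (inv ?t \<otimes> s \<otimes> ?t))"
      by (intro sum.cong refl) (simp add: induced_rep_def Let_def f t)
    also have "\<dots> = (\<Sum>s\<in>carrier G. ?ext s)"
      by (rule sum.reindex_bij_witness[where i = "\<lambda>s. ?t \<otimes> s \<otimes> inv ?t" and j = "\<lambda>s. inv ?t \<otimes> s \<otimes> ?t"])
         (use t in \<open>simp_all add: m_assoc cancel\<close>)
    also have "\<dots> = (\<Sum>h\<in>H. ?ext h)"
      using fin HG by (intro sum.mono_neutral_right) auto
    finally show ?thesis by simp
  qed
  have "(\<Sum>s\<in>carrier G. induced_character G H chi s * f s) =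
      (\<Sum>A\<in>lcosets H. \<Sum>s\<in>carrier G. induced_rep G H chi s A A * f s)"
    unfolding induced_character_def sum_distrib_right by (rule sum.swap)
  also have "\<dots> = of_nat (card (lcosets H)) * (\<Sum>h\<in>H. chi h * f h)"
    by (simp add: coset)
  finally have sum: "(\<Sum>s\<in>carrier G. induced_character G H chi s * f s) =
      of_nat (card (lcosets H)) * (\<Sum>h\<in>H. chi h * f h)" .
  have "of_nat (Coset.order G) = (of_nat (card H) * of_nat (card (lcosets H)) :: complex)"
    unfolding l_lagrange[OF fin H, symmetric] by (simp add: mult.commute)
  then show ?thesis unfolding sum by (simp only: mult.assoc)
qed

lemma orbit_conjugate:
  assumes "inj t" "\<And>x. s' (t x) = t (s x)"
  shows "orbit s' (t x) = t ` orbit s x"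
proof -
  have "(s' ^^ k) (t x) = t ((s ^^ k) x)" for k by (induction k) (simp_all add: assms)
  then show ?thesis unfolding orbit_altdef by auto
qed

lemma cycle_power_sum_conjugate:
  assumes "t permutes {1..n}"
  shows "cycle_power_sum n (inv' t \<circ> s \<circ> t) = cycle_power_sum n s"
proof -
  have orb: "orbit s (t x) = t ` orbit (inv' t \<circ> s \<circ> t) x" for x
    using assms by (intro orbit_conjugate) (auto simp: permutes_inj permutes_inverses)
  have inj: "inj ((`) t)" using permutes_inj[OF assms] by (simp add: inj_image_eq_iff inj_def)
  have "orbit s ` {1..n} = orbit s ` t ` {1..n}" using permutes_image[OF assms] by simp
  also have "\<dots> = (`) t ` orbit (inv' t \<circ> s \<circ> t) ` {1..n}" by (auto simp: orb image_image)
  finally have "cycle_power_sum n s =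
      (\<Prod>B\<in>orbit (inv' t \<circ> s \<circ> t) ` {1..n}. power_sum (card (t ` B)))"
    unfolding cycle_power_sum_def
    by (simp add: prod.reindex[OF inj_on_subset[OF inj]])
  then show ?thesis
    unfolding cycle_power_sum_def
    by (simp add: card_image[OF inj_on_subset[OF permutes_inj[OF assms]]])
qed

lemma long_cycle_permutes: "long_cycle n permutes {1..n}"
  unfolding long_cycle_def by (rule permutes_subset[OF cycle_permutes]) auto

lemma long_cycle_funpow:
  assumes "x \<in> {1..n}"
  shows "(long_cycle n ^^ k) x = Suc ((x - 1 + k) mod n)"
proof -
  have n: "n \<ge> 1" using assms by simp
  have "x = (long_cycle n ^^ (x - 1)) 1"
  proof -
    have "(x - 1) mod n = x - 1" using assms by (intro mod_less) auto
    then show ?thesis unfolding long_cycle_funpow_1[OF n] using assms by simp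
  qed
  then have "(long_cycle n ^^ k) x = (long_cycle n ^^ (k + (x - 1))) 1"
    by (metis funpow_add comp_apply)
  then show ?thesis unfolding long_cycle_funpow_1[OF n] by (simp add: add.commute)
qed

lemma long_cycle_funpow_id: "n \<ge> 1 \<Longrightarrow> long_cycle n ^^ n = id"
proof
  fix x
  have p: "long_cycle n ^^ n permutes {1..n}" by (intro permutes_funpow long_cycle_permutes)
  show "(long_cycle n ^^ n) x = id x"
  proof (cases "x \<in> {1..n}")
    case True
    then have "(x - 1 + n) mod n = x - 1" by (simp only: mod_add_self2) (auto intro: mod_less)
    then show ?thesis using True by (simp only: long_cycle_funpow[OF True]) simp
  next
    case False
    then show ?thesis using permutes_not_in[OF p] by simp
  qed
qed

lemma cyclic_subgroup_eq:
  assumes "n \<ge> 1"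
  shows "cyclic_subgroup n = (\<lambda>j. long_cycle n ^^ j) ` {1..n}"
    and "inj_on (\<lambda>j. long_cycle n ^^ j) {1..n}"
    and "subgroup (cyclic_subgroup n) (sym_group n)"
proof -
  interpret G: group "sym_group n" by (rule sym_group_is_group)
  let ?c = "long_cycle n"
  have c: "?c \<in> carrier (sym_group n)" using long_cycle_permutes by (simp add: sym_group_carrier)
  show "subgroup (cyclic_subgroup n) (sym_group n)"
    unfolding cyclic_subgroup_def using c by (intro G.generate_is_subgroup) simp
  then interpret H: subgroup "cyclic_subgroup n" "sym_group n" .
  have cn: "?c ^^ (n * m + r) = ?c ^^ r" for m r
  proof -
    have "?c ^^ (n * m) = (?c ^^ n) ^^ m" by (simp add: funpow_mult)
    also have "\<dots> = id" unfolding long_cycle_funpow_id[OF assms] by (rule id_funpow)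
    finally show ?thesis by (simp add: funpow_add)
  qed
  have mem: "?c ^^ k \<in> (\<lambda>j. ?c ^^ j) ` {1..n}" for k
  proof -
    have "?c ^^ k = ?c ^^ (k mod n)" using cn[of "k div n" "k mod n"] by simp
    moreover have "?c ^^ 0 = ?c ^^ n" using cn[of 1 0] by simp
    ultimately have "?c ^^ k = ?c ^^ (if k mod n = 0 then n else k mod n)" by simp
    moreover have "(if k mod n = 0 then n else k mod n) \<in> {1..n}"
      using assms by (auto simp: Suc_le_eq)
    ultimately show ?thesis by (rule image_eqI)
  qed
  have "h \<in> (\<lambda>j. ?c ^^ j) ` {1..n}" if "h \<in> generate (sym_group n) {?c}" for h
    using that
  proof (induction rule: generate.induct)
    case one
    then show ?case using mem[of 0] unfolding sym_group_one funpow.simps by blast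
  next
    case (incl h)
    moreover have "?c ^^ 1 = ?c" by simp
    ultimately show ?case using mem[of 1] by auto
  next
    case (inv h)
    have "?c ^^ (n - 1) \<circ> ?c = id"
      using long_cycle_funpow_id[OF assms] funpow_Suc_right[of "n - 1" ?c] assms by simp
    moreover have "?c ^^ (n - 1) \<in> carrier (sym_group n)"
      using permutes_funpow[OF long_cycle_permutes] by (simp add: sym_group_carrier)
    ultimately have "inv\<^bsub>sym_group n\<^esub> ?c = ?c ^^ (n - 1)"
      using c by (intro G.inv_equality) (simp_all add: sym_group_mult sym_group_one)
    then show ?case using inv mem[of "n - 1"] by auto
  next
    case (eng h1 h2)
    then obtain i j where "h1 = ?c ^^ i" "h2 = ?c ^^ j" by auto
    then have "h1 \<otimes>\<^bsub>sym_group n\<^esub> h2 = ?c ^^ (i + j)" by (simp add: sym_group_mult funpow_add)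
    then show ?case using mem[of "i + j"] by simp
  qed
  moreover have "?c ^^ j \<in> cyclic_subgroup n" for j
  proof (induction j)
    case 0
    then show ?case using H.one_closed unfolding sym_group_one funpow.simps .
  next
    case (Suc j)
    have "?c \<in> cyclic_subgroup n" unfolding cyclic_subgroup_def by (intro generate.incl) simp
    from H.m_closed[OF this Suc] show ?case unfolding sym_group_mult funpow.simps .
  qed
  ultimately show "cyclic_subgroup n = (\<lambda>j. ?c ^^ j) ` {1..n}"
    unfolding cyclic_subgroup_def by blast
  show "inj_on (\<lambda>j. ?c ^^ j) {1..n}"
  proof (rule inj_onI)
    fix i j assume *: "i \<in> {1..n}" "j \<in> {1..n}" "?c ^^ i = ?c ^^ j"
    have mod: "k mod n = (if k = n then 0 else k)" if "k \<in> {1..n}" for k using that by auto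
    have "Suc (i mod n) = Suc (j mod n)"
      using arg_cong[OF *(3), of "\<lambda>f. f 1"] unfolding long_cycle_funpow_1[OF assms] .
    then show "i = j" using mod[OF *(1)] mod[OF *(2)] *(1,2) by (simp split: if_splits)
  qed
qed

text \<open>
  With \<open>d = n div gcd j n\<close>, the \<open>k\<close>-th power of the permutation fixes a point exactly if
  \<open>d\<close> divides \<open>k\<close>. So all orbits have \<open>d\<close> elements, and counting points gives their number.
\<close>

lemma cycle_power_sum_long_cycle:
  assumes n: "n \<ge> 1" and j: "j \<in> {1..n}"
  shows "cycle_power_sum n (long_cycle n ^^ j) = power_sum (n div gcd j n) ^ gcd j n"
proof -
  define g where "g = gcd j n"
  define d where "d = n div g"
  have nd: "n = g * d" by (simp add: d_def g_def)
  with n have pos: "g > 0" "d > 0" by auto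
  let ?s = "long_cycle n ^^ j"
  have perm: "?s permutes {1..n}" by (intro permutes_funpow long_cycle_permutes)
  have dvd_iff: "n dvd k * j \<longleftrightarrow> d dvd k" for k
  proof -
    obtain i where i: "j = g * i" unfolding g_def by (metis gcd_dvd1 dvdE)
    have "gcd (g * i) (g * d) = g" using i nd g_def by metis
    then have "coprime d i" using pos by (simp add: gcd_mult_distrib_nat[symmetric] coprime_iff_gcd_eq_1 gcd.commute)
    have "n dvd k * j \<longleftrightarrow> d dvd k * i" using pos unfolding i nd by (simp add: mult.left_commute)
    then show ?thesis using \<open>coprime d i\<close> by (simp add: coprime_dvd_mult_left_iff)
  qed
  have pow: "(?s ^^ k) x = Suc ((x - 1 + k * j) mod n)" if "x \<in> {1..n}" for k x
    using that by (simp add: funpow_mult long_cycle_funpow mult.commute)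
  have eq_iff: "(?s ^^ k) x = (?s ^^ l) x \<longleftrightarrow> d dvd l - k" if "x \<in> {1..n}" "k \<le> l" for k l x
  proof -
    have "(?s ^^ k) x = (?s ^^ l) x \<longleftrightarrow> n dvd (x - 1 + l * j) - (x - 1 + k * j)"
      unfolding pow[OF that(1)] nat.inject
      using mod_eq_dvd_iff_nat[of "x - 1 + k * j" "x - 1 + l * j" n] that(2) by auto
    also have "(x - 1 + l * j) - (x - 1 + k * j) = (l - k) * j" by (simp add: diff_mult_distrib)
    finally show ?thesis by (simp add: dvd_iff)
  qed
  have card_orbit: "card (orbit ?s x) = d" if x: "x \<in> {1..n}" for x
  proof -
    have "orbit ?s x = (\<lambda>k. (?s ^^ k) x) ` {..<d}"
    proof (intro equalityI subsetI)
      fix y assume "y \<in> orbit ?s x"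
      then obtain k where "y = (?s ^^ k) x" by (auto simp: orbit_altdef)
      moreover have "(?s ^^ (k mod d)) x = (?s ^^ k) x"
        using x by (subst eq_iff) (simp_all add: minus_mod_eq_mult_div)
      ultimately show "y \<in> (\<lambda>k. (?s ^^ k) x) ` {..<d}" using pos by (auto intro!: image_eqI[of _ _ "k mod d"])
    next
      fix y assume "y \<in> (\<lambda>k. (?s ^^ k) x) ` {..<d}"
      then obtain k where "y = (?s ^^ k) x" by auto
      moreover have "(?s ^^ k) x = (?s ^^ (k + d)) x" using x by (subst eq_iff) simp_all
      ultimately show "y \<in> orbit ?s x" using pos unfolding orbit_altdef by auto
    qed
    moreover have "inj_on (\<lambda>k. (?s ^^ k) x) {..<d}"
    proof (rule linorder_inj_onI)
      fix k l assume "k < l" "k \<in> {..<d}" "l \<in> {..<d}"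
      then show "(?s ^^ k) x \<noteq> (?s ^^ l) x" using x by (subst eq_iff) (auto dest: dvd_imp_le)
    qed auto
    ultimately show ?thesis by (simp add: card_image)
  qed
  let ?C = "orbit ?s ` {1..n}"
  have self: "x \<in> orbit ?s x" for x
    using perm by (intro permutation_self_in_orbit) (auto simp: permutation_permutes)
  have sub: "orbit ?s x \<subseteq> {1..n}" if "x \<in> {1..n}" for x
    using permutes_orbit_subset[OF perm that] .
  have "card ?C = g"
  proof -
    have "d * card ?C = card (\<Union>?C)"
    proof (rule card_partition)
      show "finite ?C" by simp
      have U: "\<Union>?C = {1..n}" using self sub by blast
      then show "finite (\<Union>?C)" by simp
      show "\<And>c. c \<in> ?C \<Longrightarrow> card c = d" using card_orbit by auto
      show "c1 \<inter> c2 = {}" if c: "c1 \<in> ?C" "c2 \<in> ?C" "c1 \<noteq> c2" for c1 c2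
      proof (rule ccontr)
        assume "c1 \<inter> c2 \<noteq> {}"
        then obtain z where "z \<in> c1" "z \<in> c2" by blast
        moreover have "orbit ?s z = c" if "c \<in> ?C" "z \<in> c" for c
          using that orbit_cyclic_eq3[OF cyclic_on_orbit[OF perm]] by auto
        ultimately show False using c by blast
      qed
    qed
    also have "\<Union>?C = {1..n}" using self sub by blast
    finally show ?thesis using nd pos by simp
  qed
  moreover have "cycle_power_sum n ?s = (\<Prod>B\<in>?C. power_sum d)"
    unfolding cycle_power_sum_def by (intro prod.cong refl) (auto simp: card_orbit)
  ultimately show ?thesis by (simp add: d_def g_def)
qed

lemma mcoeff_sum: "mcoeff (sum f A) m = (\<Sum>x\<in>A. mcoeff (f x) m)"
  by (induction A rule: infinite_finite_induct) (simp_all add: zero_mps.rep_eq plus_mps.rep_eq)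

text \<open>
  The Frobenius characteristic of the induced character is the average of
  \<open>cyclic_character n r h\<close> times the cycle type power sum of \<open>h\<close> over the cyclic group itself.
\<close>

lemma mcoeff_ell:
  assumes n: "n \<ge> 1"
  shows "of_nat n * mcoeff (ell n r) m =
    (\<Sum>j=1..n. mcoeff (power_sum (n div gcd j n) ^ gcd j n) m * unit_root n ^ (r * j))"
proof -
  interpret G: group "sym_group n" by (rule sym_group_is_group)
  let ?f = "\<lambda>s. mcoeff (cycle_power_sum n s) m"
  let ?chi = "cyclic_character n r"
  have fin: "finite (carrier (sym_group n))"
    by (simp add: sym_group_def finite_permutations)
  have ord: "Coset.order (sym_group n) = fact n"
    by (simp add: Coset.order_def sym_group_def card_permutations)
  note H = cyclic_subgroup_eq[OF n]
  have "card (cyclic_subgroup n) = n" using H by (simp add: card_image)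
  moreover have "of_nat (card (cyclic_subgroup n)) *
      (\<Sum>s\<in>carrier (sym_group n). induced_character (sym_group n) (cyclic_subgroup n) ?chi s * ?f s) =
      of_nat (Coset.order (sym_group n)) * (\<Sum>h\<in>cyclic_subgroup n. ?chi h * ?f h)"
    by (rule G.sum_induced_character[OF fin H(3)])
       (auto simp: sym_group_carrier sym_group_mult cycle_power_sum_conjugate)
  ultimately have "of_nat n * mcoeff (ell n r) m = (\<Sum>h\<in>cyclic_subgroup n. ?chi h * ?f h)"
    by (simp add: ell_def frobenius_ch_def mps_scale.rep_eq mcoeff_sum ord)
  also have "\<dots> = (\<Sum>j=1..n. ?chi (long_cycle n ^^ j) * ?f (long_cycle n ^^ j))"
    unfolding H(1) using H(2) by (simp add: sum.reindex)
  also have "\<dots> = (\<Sum>j=1..n. mcoeff (power_sum (n div gcd j n) ^ gcd j n) m * unit_root n ^ (r * j))"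
  proof (intro sum.cong refl)
    fix j assume j: "j \<in> {1..n}"
    have "?chi (long_cycle n ^^ j) = unit_root n ^ (r * j)"
      unfolding cyclic_character_funpow[OF n] power_mult unit_root_power ..
    then show "?chi (long_cycle n ^^ j) * ?f (long_cycle n ^^ j) =
        mcoeff (power_sum (n div gcd j n) ^ gcd j n) m * unit_root n ^ (r * j)"
      by (simp add: cycle_power_sum_long_cycle[OF n j])
  qed
  finally show ?thesis .
qed

section \<open>The major index on words with given content\<close>

text \<open>
  Words are read from right to left: in \<open>y # x # w\<close> the letter \<open>y\<close> comes last, and the position
  of \<open>x\<close> counted from the start of the word is \<open>length (x # w)\<close>. The relation says when two
  neighbours form a descent. It is \<open><\<close> for words, and \<open>>\<close> for recording words, where
  the descents of a standard tableau are the steps to a lower row, that is, a larger row index.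
\<close>

fun major_index :: "('a \<Rightarrow> 'a \<Rightarrow> bool) \<Rightarrow> 'a list \<Rightarrow> nat" where
  "major_index R (y # x # w) = (if R y x then length (x # w) else 0) + major_index R (x # w)"
| "major_index R w = 0"

text \<open>
  The \<open>q\<close>-Pochhammer symbol, without the usual division by powers of \<open>1 - q\<close>, so that it makes
  sense in any commutative ring and can be specialised to roots of unity.
\<close>

definition q_factorial :: "'a::comm_ring_1 \<Rightarrow> nat \<Rightarrow> 'a" where
  "q_factorial q m = (\<Prod>j=1..m. 1 - q ^ j)"

lemma q_factorial_0 [simp]: "q_factorial q 0 = 1"
  and q_factorial_Suc: "q_factorial q (Suc m) = q_factorial q m * (1 - q ^ Suc m)"
  by (simp_all add: q_factorial_def)

lemma prod_q_factorial_remove: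
  fixes M :: "nat multiset"
  assumes "x \<in># M" "set_mset M \<subseteq> {..<N}"
  shows "(\<Prod>z<N. q_factorial q (count M z)) =
         (1 - q ^ count M x) * (\<Prod>z<N. q_factorial q (count (M - {#x#}) z))"
proof -
  have x: "x \<in> {..<N}" using assms by auto
  from assms(1) obtain c where c: "count M x = Suc c" by (metis count_greater_zero_iff gr0_implies_Suc)
  have "(\<Prod>z\<in>{..<N} - {x}. q_factorial q (count (M - {#x#}) z)) =
      (\<Prod>z\<in>{..<N} - {x}. q_factorial q (count M z))"
    by (intro prod.cong) auto
  then show ?thesis
    using prod.remove[OF _ x, of "\<lambda>z. q_factorial q (count M z)"]
      prod.remove[OF _ x, of "\<lambda>z. q_factorial q (count (M - {#x#}) z)"] c
    by (simp add: q_factorial_Suc mult_ac del: count_diff) (simp add: mult_ac)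
qed

definition size_at_least :: "nat multiset \<Rightarrow> nat \<Rightarrow> nat" where
  "size_at_least M x = size (filter_mset (\<lambda>z. x \<le> z) M)"

lemma size_at_least_Suc: "size_at_least M x = size_at_least M (Suc x) + count M x"
proof -
  have "filter_mset (\<lambda>z. x \<le> z) M = filter_mset (\<lambda>z. Suc x \<le> z) M + filter_mset (\<lambda>z. z = x) M"
    by (rule multiset_eqI) auto
  then show ?thesis
    by (simp add: size_at_least_def filter_eq_replicate_mset)
qed

lemma size_at_least_0: "size_at_least M 0 = size M"
  by (simp add: size_at_least_def)

lemma size_at_least_all: "set_mset M \<subseteq> {..<N} \<Longrightarrow> N \<le> x \<Longrightarrow> size_at_least M x = 0"
  by (auto simp: size_at_least_def filter_mset_eq_conv)

text \<open>
  The factor \<open>q ^ size M\<close> for \<open>x > y\<close> is the weight of a descent from \<open>x\<close> to \<open>y\<close>. With it, and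
  up to the common factor \<open>q ^ size_at_least M (Suc y)\<close>, the exponent belonging to \<open>x\<close> is the number
  of letters of \<open>M\<close> after \<open>x\<close> in the cyclic order \<open>y + 1, \<dots>, N - 1, 0, \<dots>, y\<close>. The sum telescopes
  separately over \<open>x \<le> y\<close> and over \<open>x > y\<close>.
\<close>

lemma q_count_telescope:
  fixes q :: "'a::comm_ring_1"
  assumes M: "set_mset M \<subseteq> {..<N}"
  shows "(\<Sum>x<N. (if y < x then q ^ size M else 1) * (q ^ size_at_least M (Suc x) * (1 - q ^ count M x))) =
         q ^ size_at_least M (Suc y) * (1 - q ^ size M)"
proof -
  \<comment> \<open>the letters \<open>\<ge> x\<close> and the letters \<open>> x\<close> differ by the copies of \<open>x\<close>\<close>
  define g where "g x = q ^ size_at_least M x" for x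
  have step: "q ^ size_at_least M (Suc x) * (1 - q ^ count M x) = g (Suc x) - g x" for x
    unfolding g_def size_at_least_Suc[of M x] by (simp add: algebra_simps power_add)
  have N: "g x = 1" if "N \<le> x" for x using size_at_least_all[OF M that] by (simp add: g_def)
  have "(\<Sum>x<N. (if y < x then q ^ size M else 1) * (g (Suc x) - g x)) =
      (if y < N then g (Suc y) - g 0 + q ^ size M * (g N - g (Suc y)) else g N - g 0)" for N
  proof (induction N)
    case (Suc N)
    then show ?case
      by (cases "y < N"; cases "y = N") (simp_all add: algebra_simps)
  qed simp
  from this[of N] have "(\<Sum>x<N. (if y < x then q ^ size M else 1) * (g (Suc x) - g x)) = 
      g (Suc y) - g 0 + q ^ size M * (1 - g (Suc y))"
    using N[of N] N[of "Suc y"] by auto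
  then show ?thesis
    unfolding step by (simp add: g_def size_at_least_0 algebra_simps)
qed

text \<open>
  Keeping track of the last letter \<open>y\<close> makes MacMahon's theorem provable by induction: the
  words of content \<open>M\<close> followed by \<open>y\<close> have a \<open>q\<close>-multinomial generating function up to a
  power of \<open>q\<close> given by the number of letters above \<open>y\<close>. The recursion over the letter
  before \<open>y\<close> is the \<open>q\<close>-Pascal rule, which is the preceding telescoping sum.
\<close>

lemma macmahon_last_letter:
  fixes q :: "'a::comm_ring_1"
  assumes "set_mset M \<subseteq> {..<N}"
  shows "(\<Prod>z<N. q_factorial q (count M z)) *
           (\<Sum>w\<in>permutations_of_multiset M. q ^ major_index (<) (y # w)) =
         q ^ size_at_least M (Suc y) * q_factorial q (size M)"
  using assms
proof (induction M arbitrary: y rule: multiset_remove_induct)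
  case empty
  then show ?case by (simp add: size_at_least_def)
next
  case (remove M)
  let ?D = "\<lambda>M. \<Prod>z<N. q_factorial q (count M z)"
  obtain s where s: "size M = Suc s" using remove.hyps(1) by (cases "size M") auto
  have "(\<Sum>w\<in>permutations_of_multiset M. q ^ major_index (<) (y # w)) =
      (\<Sum>x\<in>set_mset M. \<Sum>w\<in>permutations_of_multiset (M - {#x#}). q ^ major_index (<) (y # x # w))"
    unfolding permutations_of_multiset_nonempty[OF remove.hyps(1)]
    by (subst sum.UNION_disjoint) (auto simp: sum.reindex)
  also have "\<dots> = (\<Sum>x\<in>set_mset M. \<Sum>w\<in>permutations_of_multiset (M - {#x#}).
      (if y < x then q ^ size M else 1) * q ^ major_index (<) (x # w))"
  proof (intro sum.cong refl)
    fix x w assume "x \<in> set_mset M" "w \<in> permutations_of_multiset (M - {#x#})"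
    then have "length (x # w) = size M"
      using length_finite_permutations_of_multiset[of w] s by (simp add: size_Diff_singleton)
    then show "q ^ major_index (<) (y # x # w) = (if y < x then q ^ size M else 1) * q ^ major_index (<) (x # w)"
      by (simp add: power_add)
  qed
  finally have "?D M * (\<Sum>w\<in>permutations_of_multiset M. q ^ major_index (<) (y # w)) =
      (\<Sum>x\<in>set_mset M. (if y < x then q ^ size M else 1) *
        (?D M * (\<Sum>w\<in>permutations_of_multiset (M - {#x#}). q ^ major_index (<) (x # w))))"
    by (simp add: sum_distrib_left mult_ac)
  also have "\<dots> = (\<Sum>x\<in>set_mset M. (if y < x then q ^ size M else 1) *
        (q ^ size_at_least M (Suc x) * (1 - q ^ count M x)) * q_factorial q s)"
  proof (intro sum.cong refl)
    fix x assume x: "x \<in> set_mset M"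
    have "set_mset (M - {#x#}) \<subseteq> {..<N}" using remove.prems by (auto dest: in_diffD)
    from remove.IH[OF x this, of x]
    have IH: "?D (M - {#x#}) * (\<Sum>w\<in>permutations_of_multiset (M - {#x#}). q ^ major_index (<) (x # w)) =
        q ^ size_at_least M (Suc x) * q_factorial q s"
      using x s by (simp add: size_at_least_def size_Diff_singleton)
    have "?D M * (\<Sum>w\<in>permutations_of_multiset (M - {#x#}). q ^ major_index (<) (x # w)) =
        (1 - q ^ count M x) * (q ^ size_at_least M (Suc x) * q_factorial q s)"
      unfolding prod_q_factorial_remove[OF x remove.prems] IH[symmetric] by (simp only: mult.assoc)
    then show "(if y < x then q ^ size M else 1) *
        (?D M * (\<Sum>w\<in>permutations_of_multiset (M - {#x#}). q ^ major_index (<) (x # w))) =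
        (if y < x then q ^ size M else 1) *
        (q ^ size_at_least M (Suc x) * (1 - q ^ count M x)) * q_factorial q s"
      by (simp add: mult_ac)
  qed
  also have "\<dots> = (\<Sum>x<N. (if y < x then q ^ size M else 1) *
        (q ^ size_at_least M (Suc x) * (1 - q ^ count M x)) * q_factorial q s)"
    using remove.prems by (intro sum.mono_neutral_left) (auto simp: not_in_iff)
  also have "\<dots> = q ^ size_at_least M (Suc y) * q_factorial q (size M)"
    unfolding sum_distrib_right[symmetric] q_count_telescope[OF remove.prems]
    by (simp add: s q_factorial_Suc mult_ac)
  finally show ?case .
qed

text \<open>
  A final letter larger than all others creates no descent and has no letters
  above it, so this is an instance of the preceding lemma.
\<close>

theorem macmahon:
  fixes q :: "'a::comm_ring_1" and M :: "nat multiset"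
  assumes "set_mset M \<subseteq> {..<N}"
  shows "(\<Prod>z<N. q_factorial q (count M z)) *
           (\<Sum>w\<in>permutations_of_multiset M. q ^ major_index (<) w) = q_factorial q (size M)"
proof -
  have "major_index (<) (N # w) = major_index (<) w" if "w \<in> permutations_of_multiset M" for w
  proof (cases w)
    case (Cons x v)
    then have "x < N" using that assms by (auto simp: permutations_of_multiset_def)
    then have "\<not> N < x" by linarith
    then show ?thesis by (simp add: Cons)
  qed simp
  then show ?thesis
    using macmahon_last_letter[OF assms, of q N] size_at_least_all[OF assms, of "Suc N"] by simp
qed

text \<open>
  What remains of the \<open>q\<close>-factorial after one factor \<open>1 - q ^ d\<close> has been removed from each
  \<open>1 - q ^ j\<close> with \<open>d dvd j\<close>. Unlike the \<open>q\<close>-factorial it does not vanish at primitive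
  \<open>d\<close>-th roots of unity.
\<close>

definition reduced_q_factorial :: "nat \<Rightarrow> 'a::comm_ring_1 \<Rightarrow> nat \<Rightarrow> 'a" where
  "reduced_q_factorial d q m =
     (\<Prod>j=1..m. if d dvd j then \<Sum>i<j div d. (q ^ d) ^ i else 1 - q ^ j)"

lemma q_factorial_eq_reduced:
  assumes "d > 0"
  shows "q_factorial q m = (1 - q ^ d) ^ (m div d) * reduced_q_factorial d q m"
proof (induction m)
  case 0
  show ?case by (simp add: reduced_q_factorial_def)
next
  case (Suc m)
  have red: "reduced_q_factorial d q (Suc m) = reduced_q_factorial d q m *
      (if d dvd Suc m then \<Sum>i<Suc m div d. (q ^ d) ^ i else 1 - q ^ Suc m)"
    by (simp add: reduced_q_factorial_def)
  show ?case
  proof (cases "d dvd Suc m")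
    case True
    define S where "S = (\<Sum>i<Suc m div d. (q ^ d) ^ i)"
    have "1 - q ^ Suc m = 1 - (q ^ d) ^ (Suc m div d)"
      using True by (simp only: power_mult[symmetric] dvd_mult_div_cancel)
    also have "\<dots> = (1 - q ^ d) * S" unfolding S_def by (rule one_diff_power_eq)
    finally have "1 - q ^ Suc m = (1 - q ^ d) * S" .
    moreover have "reduced_q_factorial d q (Suc m) = reduced_q_factorial d q m * S"
      using red True by (simp add: S_def)
    moreover have "Suc m div d = Suc (m div d)"
      using True by (simp add: div_Suc dvd_eq_mod_eq_0)
    ultimately show ?thesis
      by (simp only: q_factorial_Suc Suc power_Suc mult_ac)
  next
    case False
    then show ?thesis
      using Suc red by (simp add: q_factorial_Suc div_Suc dvd_eq_mod_eq_0 mult_ac del: power_Suc)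
  qed
qed

locale primitive_root =
  fixes d :: nat and \<zeta> :: complex
  assumes d_pos: "d > 0" and power_eq_1: "\<zeta> ^ j = 1 \<longleftrightarrow> d dvd j"
begin

text \<open>
  The part of the value of the reduced \<open>q\<close>-factorial at \<open>\<zeta>\<close> that cancels from
  a multinomial coefficient all of whose entries are divisible by \<open>d\<close>.
\<close>

definition cofactor :: "nat \<Rightarrow> complex" where
  "cofactor m = (\<Prod>j=1..m. if d dvd j then 1 else 1 - \<zeta> ^ j)"

lemma cofactor_nonzero: "cofactor m \<noteq> 0"
  by (auto simp: cofactor_def power_eq_1)

lemma reduced_q_factorial_root: "reduced_q_factorial d \<zeta> m = fact (m div d) * cofactor m"
proof (induction m)
  case (Suc m)
  have "\<zeta> ^ d = 1" by (simp add: power_eq_1)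
  with Suc d_pos show ?case
    by (simp add: reduced_q_factorial_def cofactor_def div_Suc dvd_eq_mod_eq_0 mult_ac)
qed (simp add: reduced_q_factorial_def cofactor_def)

lemma cofactor_add: "d dvd a \<Longrightarrow> cofactor (a + b) = cofactor a * cofactor b"
proof (induction b)
  case (Suc b)
  have "\<zeta> ^ (a + Suc b) = \<zeta> ^ Suc b" using Suc.prems power_eq_1[of a] by (simp only: power_add) simp
  moreover have "d dvd a + Suc b \<longleftrightarrow> d dvd Suc b" using Suc.prems by (rule dvd_add_right_iff)
  ultimately show ?case using Suc by (simp add: cofactor_def mult_ac)
qed (simp add: cofactor_def)

lemma cofactor_sum:
  "finite A \<Longrightarrow> (\<And>x. x \<in> A \<Longrightarrow> d dvd c x) \<Longrightarrow> cofactor (\<Sum>x\<in>A. c x) = (\<Prod>x\<in>A. cofactor (c x))"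
  by (induction A rule: finite_induct) (simp_all add: cofactor_add, simp add: cofactor_def)

text \<open>
  In the polynomial identity of MacMahon both sides vanish at \<open>\<zeta>\<close> in general. The power of
  \<open>1 - X ^ d\<close> is \<open>\<Sum>x. count M x div d\<close> on the left and \<open>size M div d\<close> on the right. After the
  smaller power on the left is cancelled, the rest may be evaluated; a positive power is left
  on the right exactly if some multiplicity is not divisible by \<open>d\<close>.
\<close>

lemma macmahon_at_root:
  fixes M :: "nat multiset"
  assumes M: "set_mset M \<subseteq> {..<N}" and size: "d dvd size M"
  shows "(\<Prod>x<N. fact (count M x div d)) *
           (\<Sum>w\<in>permutations_of_multiset M. \<zeta> ^ major_index (<) w) =
         (if \<forall>x. d dvd count M x then fact (size M div d) else 0)"
proof -
  \<comment> \<open>\<open>\<zeta>\<close> is replaced by an indeterminate, for which cancellation is possible\<close>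
  define X :: "complex poly" where "X = [:0, 1:]"
  have poly_X: "poly X z = z" for z by (simp add: X_def)
  define G where "G = (\<Sum>w\<in>permutations_of_multiset M. X ^ major_index (<) w)"
  define S where "S = (\<Sum>x<N. count M x div d)"
  have poly_red: "poly (reduced_q_factorial d X m) z = reduced_q_factorial d z m" for m z
    by (auto simp: reduced_q_factorial_def poly_prod poly_sum poly_power poly_X intro!: prod.cong)
  have size_sum: "size M = (\<Sum>x<N. count M x)"
    unfolding size_multiset_overloaded_eq using M
    by (intro sum.mono_neutral_left) (auto simp: count_eq_zero_iff)
  then have "d * S \<le> size M" unfolding S_def by (simp add: sum_distrib_left sum_mono)
  then have S: "S \<le> size M div d" using d_pos by (simp add: less_eq_div_iff_mult_less_eq mult.commute)
  have root: "\<zeta> ^ d = 1" by (simp add: power_eq_1)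
  have "X ^ d \<noteq> 1" 
  proof
    assume "X ^ d = 1"
    then have "poly (X ^ d) 0 = poly 1 0" by simp
    then show False using d_pos by (simp add: poly_power poly_X zero_power)
  qed
  then have nz: "(1 - X ^ d) ^ S \<noteq> 0" by simp
  have "(1 - X ^ d) ^ S * ((\<Prod>x<N. reduced_q_factorial d X (count M x)) * G) =
      (\<Prod>x<N. q_factorial X (count M x)) * G"
    unfolding S_def q_factorial_eq_reduced[OF d_pos] by (simp add: prod.distrib power_sum mult_ac)
  also have "\<dots> = q_factorial X (size M)" unfolding G_def by (rule macmahon[OF M])
  also have "\<dots> = (1 - X ^ d) ^ S * ((1 - X ^ d) ^ (size M div d - S) * reduced_q_factorial d X (size M))"
    using S by (simp add: q_factorial_eq_reduced[OF d_pos] power_add[symmetric] mult.assoc[symmetric])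
  finally have "(\<Prod>x<N. reduced_q_factorial d X (count M x)) * G =
      (1 - X ^ d) ^ (size M div d - S) * reduced_q_factorial d X (size M)"
    using nz by (metis mult_left_cancel)
  then have "poly ((\<Prod>x<N. reduced_q_factorial d X (count M x)) * G) \<zeta> =
      poly ((1 - X ^ d) ^ (size M div d - S) * reduced_q_factorial d X (size M)) \<zeta>" by simp
  then have *: "(\<Prod>x<N. fact (count M x div d)) * (\<Prod>x<N. cofactor (count M x)) *
      (\<Sum>w\<in>permutations_of_multiset M. \<zeta> ^ major_index (<) w) =
      0 ^ (size M div d - S) * (fact (size M div d) * cofactor (size M))"
    by (simp add: poly_prod poly_red poly_power poly_X G_def poly_sum reduced_q_factorial_root
        prod.distrib root)
  show ?thesis
  proof (cases "\<forall>x. d dvd count M x")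
    case True
    then have "d * S = size M" unfolding S_def size_sum by (simp add: sum_distrib_left)
    then have "S = size M div d" using d_pos by (metis nonzero_mult_div_cancel_left not_gr_zero)
    moreover have "cofactor (size M) = (\<Prod>x<N. cofactor (count M x))"
      unfolding size_sum using True by (intro cofactor_sum) auto
    moreover have "(\<Prod>x<N. cofactor (count M x)) \<noteq> 0" by (simp add: cofactor_nonzero)
    ultimately show ?thesis using * True by (simp add: mult_ac)
  next
    case False
    then obtain x where x: "\<not> d dvd count M x" by blast
    then have "x \<in># M" by (metis count_eq_zero_iff dvd_0_right)
    then have "x < N" using M by auto
    have "d * S < size M" unfolding S_def size_sum sum_distrib_left
    proof (rule sum_strict_mono_ex1)
      show "\<exists>x\<in>{..<N}. d * (count M x div d) < count M x"
        using x \<open>x < N\<close>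
        by (intro bexI[of _ x]) (metis dvd_triv_left le_neq_implies_less times_div_less_eq_dividend, simp)
    qed auto
    then have "size M div d \<noteq> S" using size by auto
    then have zero: "(0 :: complex) ^ (size M div d - S) = 0" using S by simp
    have "(\<Prod>x<N. cofactor (count M x)) \<noteq> 0" by (simp add: cofactor_nonzero)
    then have "(\<Prod>x<N. fact (count M x div d)) *
        (\<Sum>w\<in>permutations_of_multiset M. \<zeta> ^ major_index (<) w) = 0"
      using *[unfolded zero] by simp
    with False show ?thesis by (simp only: if_False)
  qed
qed

text \<open>
  A word \<open>u\<close> with \<open>repeat_mset d (mset u) = M\<close> exists only if \<open>d\<close> divides all multiplicities,
  and then there are as many as the multinomial coefficient found in the preceding lemma.
\<close>

lemma sum_root_major_index:
  fixes M :: "nat multiset"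
  assumes "d dvd size M"
  shows "(\<Sum>w\<in>permutations_of_multiset M. \<zeta> ^ major_index (<) w) =
         of_nat (card {u. length u = size M div d \<and> repeat_mset d (mset u) = M})"
proof -
  obtain N where N: "set_mset M \<subseteq> {..<N}"
    using finite_nat_set_iff_bounded[of "set_mset M"] by (metis finite_set_mset lessThan_iff subsetI)
  let ?U = "{u. length u = size M div d \<and> repeat_mset d (mset u) = M}"
  have nz: "(\<Prod>x<N. fact (count M x div d)) \<noteq> (0 :: complex)" by simp
  show ?thesis
  proof (cases "\<forall>x. d dvd count M x")
    case True
    \<comment> \<open>the only possible content of \<open>u\<close>\<close>
    define L where "L = Abs_multiset (\<lambda>x. count M x div d)"
    have L: "count L x = count M x div d" for x
    proof -
      have "finite {x. count M x div d > 0}"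
        by (rule finite_subset[OF _ finite_set_mset[of M]]) (auto intro!: count_inI)
      then show ?thesis unfolding L_def by (subst Abs_multiset_inverse) simp_all
    qed
    have rep_L: "repeat_mset d L = M" using True by (intro multiset_eqI) (simp add: L)
    then have sL: "size L = size M div d" using d_pos by auto
    have "?U = permutations_of_multiset L"
    proof -
      have "mset u = L" if "repeat_mset d (mset u) = M" for u
      proof (rule multiset_eqI)
        fix x
        have "count M x = d * count (mset u) x" using that by auto
        then show "count (mset u) x = count L x" using d_pos by (simp add: L)
      qed
      then show ?thesis using rep_L sL by (auto simp: permutations_of_multiset_def)
    qed
    moreover have "card (permutations_of_multiset L) * (\<Prod>x\<in>set_mset L. fact (count L x)) = fact (size L)"
      by (rule card_permutations_of_multiset_aux)
    moreover have "(\<Prod>x\<in>set_mset L. fact (count L x)) = (\<Prod>x<N. fact (count L x) :: nat)"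
    proof (rule prod.mono_neutral_left)
      have "set_mset L \<subseteq> set_mset M"
      proof
        fix x assume "x \<in># L"
        then have "count M x div d > 0" by (simp flip: L)
        then show "x \<in># M" by (intro count_inI) auto
      qed
      then show "set_mset L \<subseteq> {..<N}" using N by simp
    qed (auto simp: not_in_iff)
    ultimately have "card ?U * (\<Prod>x<N. fact (count M x div d)) = fact (size M div d)"
      by (simp add: L sL)
    then have "of_nat (card ?U * (\<Prod>x<N. fact (count M x div d))) = (of_nat (fact (size M div d)) :: complex)"
      by simp
    then have "(\<Prod>x<N. fact (count M x div d)) * of_nat (card ?U) = (fact (size M div d) :: complex)"
      by (simp add: mult.commute)
    then have "(\<Prod>x<N. fact (count M x div d)) *
          (\<Sum>w\<in>permutations_of_multiset M. \<zeta> ^ major_index (<) w) =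
        (\<Prod>x<N. fact (count M x div d)) * of_nat (card ?U)"
      using macmahon_at_root[OF N assms] True by simp
    then show ?thesis using mult_left_cancel[OF nz] by blast
  next
    case False
    then have U: "?U = {}" by auto
    show ?thesis using macmahon_at_root[OF N assms] False nz unfolding U by simp
  qed
qed

end

section \<open>Coefficients of power sums and of induced cyclic characters\<close>

definition monomial_of :: "nat multiset \<Rightarrow> mono" where
  "monomial_of M = (\<Sum>x\<in>#M. Poly_Mapping.single x 1)"

lemma lookup_monomial_of: "Poly_Mapping.lookup (monomial_of M) x = count M x"
  by (induction M) (auto simp: monomial_of_def lookup_add lookup_single when_def)

lemma monomial_of_eq_iff: "monomial_of M = monomial_of L \<longleftrightarrow> M = L"
  by (metis lookup_monomial_of multiset_eqI)

lemma monomial_of_surj: obtains M where "m = monomial_of M"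
proof -
  have "finite {x. Poly_Mapping.lookup m x > 0}" using finite_lookup[of m] by simp
  then have "m = monomial_of (Abs_multiset (Poly_Mapping.lookup m))"
    by (intro poly_mapping_eqI) (simp add: lookup_monomial_of Abs_multiset_inverse)
  then show ?thesis by (rule that)
qed

lemma monomial_of_add: "monomial_of (M + L) = monomial_of M + monomial_of L"
  by (simp add: monomial_of_def)

lemma monomial_of_replicate: "monomial_of (replicate_mset d i) = Poly_Mapping.single i d"
  by (rule poly_mapping_eqI) (simp add: lookup_monomial_of lookup_single when_def)

text \<open>
  A monomial in the product of \<open>e\<close> copies of \<open>power_sum d\<close> arises from choosing one variable in
  each factor, that is, from a word of length \<open>e\<close>.
\<close>

lemma mcoeff_power_sum_power:
  assumes d: "d \<ge> 1"
  shows "mcoeff (power_sum d ^ e :: 'a::comm_ring_1 mps) (monomial_of M) =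
         of_nat (card {u. length u = e \<and> repeat_mset d (mset u) = M})"
proof (induction e arbitrary: M)
  case 0
  have "{u. length u = 0 \<and> repeat_mset d (mset u) = M} = (if M = {#} then {[]} else {})" by auto
  moreover have "monomial_of M = 0 \<longleftrightarrow> M = {#}"
    using monomial_of_eq_iff[of M "{#}"] by (simp add: monomial_of_def)
  ultimately show ?case by (simp add: one_mps.rep_eq)
next
  case (Suc e)
  let ?U = "\<lambda>e M. {u. length u = e \<and> repeat_mset d (mset u) = M}"
  let ?I = "{i \<in> set_mset M. replicate_mset d i \<subseteq># M}"
  have finU: "finite (?U e L)" for e L
  proof (rule finite_subset)
    show "?U e L \<subseteq> {u. set u \<subseteq> set_mset L \<and> length u = e}"
      using d by (auto intro!: count_inI)
    show "finite {u. set u \<subseteq> set_mset L \<and> length u = e}" by (simp add: finite_lists_length_eq)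
  qed
  let ?pair = "\<lambda>i. (monomial_of (replicate_mset d i), monomial_of (M - replicate_mset d i))"
  have "mcoeff (power_sum d ^ Suc e :: 'a mps) (monomial_of M) =
      (\<Sum>p | fst p + snd p = monomial_of M.
        mcoeff (power_sum d) (fst p) * mcoeff (power_sum d ^ e :: 'a mps) (snd p))"
    by (simp add: times_mps.rep_eq)
  also have "\<dots> = (\<Sum>p\<in>?pair ` ?I.
        mcoeff (power_sum d) (fst p) * mcoeff (power_sum d ^ e :: 'a mps) (snd p))"
  proof (rule sum.mono_neutral_right)
    show "finite {p. fst p + snd p = monomial_of M}" by (rule finite_mono_splits)
    show "?pair ` ?I \<subseteq> {p. fst p + snd p = monomial_of M}"
      by (auto simp flip: monomial_of_add)
    show "\<forall>p\<in>{p. fst p + snd p = monomial_of M} - ?pair ` ?I.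
        mcoeff (power_sum d) (fst p) * mcoeff (power_sum d ^ e :: 'a mps) (snd p) = 0"
    proof
      fix p assume p: "p \<in> {p. fst p + snd p = monomial_of M} - ?pair ` ?I"
      have "\<nexists>i. fst p = Poly_Mapping.single i d"
      proof
        assume "\<exists>i. fst p = Poly_Mapping.single i d"
        then obtain i where i: "fst p = monomial_of (replicate_mset d i)" by (auto simp: monomial_of_replicate)
        obtain L where L: "snd p = monomial_of L" by (rule monomial_of_surj)
        have M: "M = replicate_mset d i + L"
          using p i L by (simp flip: monomial_of_add add: monomial_of_eq_iff)
        then have "p = ?pair i" using i L by (simp add: prod_eq_iff)
        moreover have "i \<in> ?I" using M d by auto
        ultimately show False using p by blast
      qed
      then show "mcoeff (power_sum d) (fst p) * mcoeff (power_sum d ^ e :: 'a mps) (snd p) = 0"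
        by (simp add: power_sum.rep_eq)
    qed
  qed
  also have "\<dots> = (\<Sum>i\<in>?I. mcoeff (power_sum d ^ e :: 'a mps) (monomial_of (M - replicate_mset d i)))"
  proof (subst sum.reindex)
    show "inj_on ?pair ?I"
      using d by (intro inj_onI) (auto simp: monomial_of_eq_iff replicate_mset_eq_iff)
    show "sum ((\<lambda>p. mcoeff (power_sum d) (fst p) * mcoeff (power_sum d ^ e :: 'a mps) (snd p)) \<circ> ?pair) ?I =
        (\<Sum>i\<in>?I. mcoeff (power_sum d ^ e :: 'a mps) (monomial_of (M - replicate_mset d i)))"
      by (intro sum.cong refl) (auto simp: power_sum.rep_eq monomial_of_replicate)
  qed
  also have "\<dots> = of_nat (\<Sum>i\<in>?I. card (?U e (M - replicate_mset d i)))" by (simp add: Suc.IH)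
  also have "(\<Sum>i\<in>?I. card (?U e (M - replicate_mset d i))) =
      card (Sigma ?I (\<lambda>i. ?U e (M - replicate_mset d i)))"
    by (rule card_SigmaI[symmetric]) (simp_all add: finU)
  also have "\<dots> = card (?U (Suc e) M)"
  proof (rule bij_betw_same_card[of "\<lambda>(i, u). i # u"])
    show "bij_betw (\<lambda>(i, u). i # u) (Sigma ?I (\<lambda>i. ?U e (M - replicate_mset d i))) (?U (Suc e) M)"
      unfolding bij_betw_def
    proof
      show "inj_on (\<lambda>(i, u). i # u) (Sigma ?I (\<lambda>i. ?U e (M - replicate_mset d i)))"
        by (rule inj_onI) auto
      show "(\<lambda>(i, u). i # u) ` Sigma ?I (\<lambda>i. ?U e (M - replicate_mset d i)) = ?U (Suc e) M"
      proof (intro equalityI subsetI)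
        fix v assume "v \<in> (\<lambda>(i, u). i # u) ` Sigma ?I (\<lambda>i. ?U e (M - replicate_mset d i))"
        then show "v \<in> ?U (Suc e) M" by (auto simp: repeat_mset_distrib_add_mset)
      next
        fix v assume v: "v \<in> ?U (Suc e) M"
        then obtain i u where "v = i # u" by (auto simp: length_Suc_conv)
        with v d show "v \<in> (\<lambda>(i, u). i # u) ` Sigma ?I (\<lambda>i. ?U e (M - replicate_mset d i))"
          by (auto simp: image_iff repeat_mset_distrib_add_mset)
      qed
    qed
  qed
  finally show ?case .
qed

text \<open>
  The number \<open>unit_root n ^ j\<close> is a primitive root of unity of order \<open>n div gcd j n\<close>, so each
  summand of \<open>mcoeff_ell\<close> is the major index generating function evaluated at
  \<open>unit_root n ^ j\<close>. Averaging over \<open>j\<close> selects the words with \<open>n dvd r + major_index (<) w\<close>.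
\<close>

lemma mcoeff_ell_words:
  assumes n: "n \<ge> 1"
  shows "mcoeff (ell n r) (monomial_of M) =
    of_nat (if size M = n then card {w. mset w = M \<and> n dvd r + major_index (<) w} else 0)"
proof -
  have dpos: "n div gcd j n \<ge> 1" "gcd j n * (n div gcd j n) = n" for j
    using n by (simp_all add: Suc_le_eq div_greater_zero_iff)
  show ?thesis
  proof (cases "size M = n")
    case False
    have none: "{u. length u = gcd j n \<and> repeat_mset (n div gcd j n) (mset u) = M} = {}" for j
    proof -
      have "size M = n" if "length u = gcd j n" "repeat_mset (n div gcd j n) (mset u) = M" for u
        using that dpos(2)[of j] by auto
      then show ?thesis using False by blast
    qed
    have "of_nat n * mcoeff (ell n r) (monomial_of M) = 0"
      unfolding mcoeff_ell[OF n] mcoeff_power_sum_power[OF dpos(1)] none by simp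
    with n False show ?thesis by simp
  next
    case True
    have "of_nat n * mcoeff (ell n r) (monomial_of M) =
        (\<Sum>j=1..n. \<Sum>w\<in>permutations_of_multiset M. unit_root n ^ ((r + major_index (<) w) * j))"
      unfolding mcoeff_ell[OF n]
    proof (intro sum.cong refl)
      fix j
      interpret primitive_root "n div gcd j n" "unit_root n ^ j"
      proof
        show "n div gcd j n > 0" using dpos(1)[of j] by simp
        fix k
        have "(unit_root n ^ j) ^ k = 1 \<longleftrightarrow> n dvd j * k"
          by (simp add: power_mult[symmetric] unit_root_power_eq_1_iff[OF n])
        also have "\<dots> \<longleftrightarrow> n div gcd j n dvd k"
        proof -
          have "coprime (n div gcd j n) (j div gcd j n)" using n by (simp add: div_gcd_coprime coprime_commute)
          moreover have "j * k = gcd j n * (j div gcd j n * k)" by (simp add: mult.assoc[symmetric])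
          then have "n dvd j * k \<longleftrightarrow> n div gcd j n dvd j div gcd j n * k"
            using dpos(2)[of j] n by (metis dvd_mult_cancel_left gcd_eq_0_iff not_one_le_zero nat_mult_dvd_cancel_disj)
          ultimately show ?thesis by (simp add: coprime_dvd_mult_right_iff)
        qed
        finally show "(unit_root n ^ j) ^ k = 1 \<longleftrightarrow> n div gcd j n dvd k" .
      qed
      have "size M div (n div gcd j n) = gcd j n" using dpos[of j] True
        by (metis nonzero_mult_div_cancel_right not_one_le_zero)
      moreover have "n div gcd j n dvd size M" using dpos(2)[of j] True by (metis dvd_triv_right)
      ultimately have "mcoeff (power_sum (n div gcd j n) ^ gcd j n) (monomial_of M) =
          (\<Sum>w\<in>permutations_of_multiset M. (unit_root n ^ j) ^ major_index (<) w)"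
        by (simp add: mcoeff_power_sum_power[OF dpos(1)] sum_root_major_index)
      then show "mcoeff (power_sum (n div gcd j n) ^ gcd j n) (monomial_of M) * unit_root n ^ (r * j) =
          (\<Sum>w\<in>permutations_of_multiset M. unit_root n ^ ((r + major_index (<) w) * j))"
        by (simp add: sum_distrib_left power_mult[symmetric] power_add algebra_simps)
    qed
    also have "\<dots> = (\<Sum>w\<in>permutations_of_multiset M. if n dvd r + major_index (<) w then of_nat n else 0)"
      by (subst sum.swap) (simp only: sum_unit_root_powers[OF n])
    also have "\<dots> = (\<Sum>w\<in>{w \<in> permutations_of_multiset M. n dvd r + major_index (<) w}. of_nat n)"
      by (rule sum.inter_filter[symmetric]) simp
    also have "{w \<in> permutations_of_multiset M. n dvd r + major_index (<) w} =
        {w. mset w = M \<and> n dvd r + major_index (<) w}"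
      by (auto simp: permutations_of_multiset_def)
    finally show ?thesis using n True by simp
  qed
qed

section \<open>Row insertion and descents\<close>

text \<open>
  A new letter \<open>x\<close> displaces the leftmost entry larger than \<open>x\<close>, or is appended if there is none.
\<close>

definition bump_pos :: "nat \<Rightarrow> nat list \<Rightarrow> nat" where
  "bump_pos x r = length (takeWhile (\<lambda>a. a \<le> x) r)"

definition row_insert :: "nat \<Rightarrow> nat list \<Rightarrow> nat list \<times> nat option" where
  "row_insert x r = (let i = bump_pos x r
     in if i < length r then (r[i := x], Some (r ! i)) else (r @ [x], None))"

definition dominates :: "nat list \<Rightarrow> nat list \<Rightarrow> bool" where
  "dominates r s \<longleftrightarrow> length s \<le> length r \<and> (\<forall>j<length s. r ! j < s ! j)"

text \<open>
  An absent row counts as an empty row. Since inserting into it creates the row with one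
  entry, no case distinction is needed at the bottom of a tableau.
\<close>

definition top_row :: "nat list list \<Rightarrow> nat list" where
  "top_row T = (case T of [] \<Rightarrow> [] | r # _ \<Rightarrow> r)"

lemma top_row_simps [simp]: "top_row [] = []" "top_row (r # T) = r"
  by (simp_all add: top_row_def)

fun tableau :: "nat list list \<Rightarrow> bool" where
  "tableau [] = True"
| "tableau (r # T) \<longleftrightarrow> sorted r \<and> r \<noteq> [] \<and> dominates r (top_row T) \<and> tableau T"

text \<open>
  The second component is the index of the row in which the new box appears.
\<close>

fun insert_letter :: "nat \<Rightarrow> nat list list \<Rightarrow> nat list list \<times> nat" where
  "insert_letter x [] = ([[x]], 0)"
| "insert_letter x (r # T) = (case row_insert x r of
     (r', None) \<Rightarrow> (r' # T, 0)
   | (r', Some y) \<Rightarrow> (case insert_letter y T of (T', k) \<Rightarrow> (r' # T', Suc k)))"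

text \<open>
  The shape after a box has been added to row \<open>k\<close>; a new row starts if \<open>k\<close> is the number of rows.
\<close>

fun add_box :: "nat \<Rightarrow> nat list \<Rightarrow> nat list" where
  "add_box k [] = [Suc 0]"
| "add_box 0 (l # la) = Suc l # la"
| "add_box (Suc k) (l # la) = l # add_box k la"

lemma bump_pos_le: "bump_pos x r \<le> length r"
  unfolding bump_pos_def by (rule length_takeWhile_le)

lemma before_bump_pos: "j < bump_pos x r \<Longrightarrow> r ! j \<le> x"
  unfolding bump_pos_def by (metis nth_mem set_takeWhileD takeWhile_nth)

lemma at_bump_pos: "bump_pos x r < length r \<Longrightarrow> x < r ! bump_pos x r"
  unfolding bump_pos_def using nth_length_takeWhile[of "\<lambda>a. a \<le> x" r] by simp

lemma bump_pos_leI: "i < length r \<Longrightarrow> x < r ! i \<Longrightarrow> bump_pos x r \<le> i"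
  using before_bump_pos[of i x r] by force

lemma bump_pos_geI: "i \<le> length r \<Longrightarrow> (\<And>j. j < i \<Longrightarrow> r ! j \<le> x) \<Longrightarrow> i \<le> bump_pos x r"
  by (metis at_bump_pos leD le_less_linear order_less_le_trans)

lemma row_insert_None:
  "row_insert x r = (r', None) \<longleftrightarrow> bump_pos x r = length r \<and> r' = r @ [x]"
  using bump_pos_le[of x r] by (auto simp: row_insert_def Let_def)

lemma row_insert_Some:
  "row_insert x r = (r', Some y) \<longleftrightarrow>
     bump_pos x r < length r \<and> r' = r[bump_pos x r := x] \<and> y = r ! bump_pos x r"
  by (auto simp: row_insert_def Let_def)

lemma row_insert_nonempty: "fst (row_insert x r) \<noteq> []"
  by (auto simp: row_insert_def Let_def)

lemma sorted_row_insert: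
  assumes "sorted r"
  shows "sorted (fst (row_insert x r))"
proof (cases "bump_pos x r < length r")
  case True
  let ?i = "bump_pos x r"
  have "sorted (r[?i := x])"
    unfolding sorted_iff_nth_mono_less
  proof (intro allI impI)
    fix a b assume ab: "a < b" "b < length (r[?i := x])"
    then have "r ! a \<le> r ! b"
      using assms by (simp add: sorted_nth_mono)
    moreover have "a < ?i \<Longrightarrow> r ! a \<le> x" by (rule before_bump_pos)
    moreover have "?i < b \<Longrightarrow> x \<le> r ! b"
      using at_bump_pos[OF True] sorted_nth_mono[OF assms, of ?i b] ab by simp
    moreover have "a = ?i \<or> b = ?i \<or> a \<noteq> ?i \<and> b \<noteq> ?i" by blast
    ultimately show "r[?i := x] ! a \<le> r[?i := x] ! b"
      using ab by (cases "a = ?i"; cases "b = ?i") auto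
  qed
  with True show ?thesis by (simp add: row_insert_def Let_def)
next
  case False
  then have "bump_pos x r = length r" using bump_pos_le[of x r] by simp
  then have "\<forall>a\<in>set r. a \<le> x"
    using before_bump_pos[of _ x r] by (metis in_set_conv_nth)
  with False assms show ?thesis by (auto simp: row_insert_def Let_def sorted_append)
qed

lemma top_row_insert_letter: "top_row (fst (insert_letter x T)) = fst (row_insert x (top_row T))"
  by (cases T) (auto simp: row_insert_def Let_def bump_pos_def split: prod.splits)

text \<open>
  The bumped letter \<open>y\<close> enters the row below weakly to the left of the place it came from:
  the entry below that place, if any, exceeds \<open>y\<close>.
\<close>

lemma dominates_row_insert:
  assumes r: "sorted r" and s: "sorted s" and dom: "dominates r s"
    and ins: "row_insert x r = (r', Some y)"
  shows "dominates r' (fst (row_insert y s))"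
proof -
  let ?i = "bump_pos x r" and ?j = "bump_pos y s"
  from ins have i: "?i < length r" and r': "r' = r[?i := x]" and y: "y = r ! ?i"
    by (simp_all add: row_insert_Some)
  have xy: "x < y" using at_bump_pos[OF i] y by simp
  have len: "length s \<le> length r" and lt: "\<And>j. j < length s \<Longrightarrow> r ! j < s ! j"
    using dom by (auto simp: dominates_def)
  have ji: "?j \<le> ?i"
  proof (cases "?i < length s")
    case True
    then show ?thesis using lt[OF True] y by (intro bump_pos_leI) simp_all
  next
    case False
    then show ?thesis using bump_pos_le[of y s] by simp
  qed
  have at_j: "r' ! ?j < y"
    using ji xy before_bump_pos[of ?j x r] i unfolding r' by (cases "?j = ?i") auto
  have others: "r' ! l < s ! l" if "l < length s" for l
    using lt[OF that] that len xy y i unfolding r' by (cases "l = ?i") auto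
  show ?thesis
  proof (cases "?j < length s")
    case True
    with at_j others len i r' show ?thesis
      by (auto simp: row_insert_def Let_def dominates_def nth_list_update)
  next
    case False
    then have "?j = length s" using bump_pos_le[of y s] by simp
    with at_j others ji i r' show ?thesis
      by (auto simp: row_insert_def Let_def dominates_def nth_append less_Suc_eq)
  qed
qed

lemma sorted_top_row: "tableau T \<Longrightarrow> sorted (top_row T)"
  by (cases T) simp_all

lemma tableau_insert_letter: "tableau T \<Longrightarrow> tableau (fst (insert_letter x T))"
proof (induction T arbitrary: x)
  case Nil
  then show ?case by (simp add: dominates_def)
next
  case (Cons r T)
  obtain r' o' where ins: "row_insert x r = (r', o')" by fastforce
  have r': "sorted r'" "r' \<noteq> []"
    using sorted_row_insert[of r x] row_insert_nonempty[of x r] Cons.prems ins by simp_all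
  show ?case
  proof (cases o')
    case None
    then have "r' = r @ [x]" using ins by (simp add: row_insert_None)
    then have "dominates r' (top_row T)"
      using Cons.prems by (auto simp: dominates_def nth_append)
    with None ins r' Cons.prems show ?thesis by simp
  next
    case (Some y)
    have "dominates r' (top_row (fst (insert_letter y T)))"
      unfolding top_row_insert_letter
      by (rule dominates_row_insert[where r = r and x = x])
         (use Cons.prems ins Some in \<open>auto intro: sorted_top_row\<close>)
    moreover have "tableau (fst (insert_letter y T))" using Cons by simp
    ultimately show ?thesis using Some ins r' by (simp add: case_prod_beta)
  qed
qed

lemma shape_insert_letter:
  "map length (fst (insert_letter x T)) = add_box (snd (insert_letter x T)) (map length T)"
proof (induction T arbitrary: x)
  case (Cons r T)
  show ?case using Cons.IH
    by (auto simp: row_insert_def Let_def split: prod.split)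
       (metis fst_conv snd_conv)+
qed simp

lemma content_insert_letter:
  "mset (concat (fst (insert_letter x T))) = add_mset x (mset (concat T))"
proof (induction T arbitrary: x)
  case (Cons r T)
  let ?i = "bump_pos x r"
  show ?case
  proof (cases "?i < length r")
    case True
    then have "row_insert x r = (r[?i := x], Some (r ! ?i))" by (simp add: row_insert_def Let_def)
    moreover have "add_mset (r ! ?i) (mset (r[?i := x])) = add_mset x (mset r)"
      using True by (simp add: mset_update)
    ultimately show ?thesis using Cons.IH[of "r ! ?i"]
      by (auto split: prod.split)
  next
    case False
    then show ?thesis by (simp add: row_insert_def Let_def)
  qed
qed simp

lemma row_index_le: "snd (insert_letter x T) \<le> length T"
  by (induction T arbitrary: x) (auto split: prod.split option.split, metis snd_conv)

text \<open>
  Inserting letters \<open>x \<le> y\<close> in this order bumps letters \<open>a \<le> b\<close>, and \<open>x > y\<close> bumps \<open>a > b\<close>, as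
  long as both bump something; so the comparison is passed down unchanged from row to row.
  The second insertion stops first, or in the same row, if \<open>x \<le> y\<close>, and the first
  insertion stops first if \<open>x > y\<close>.
\<close>

lemma row_bumping:
  assumes "tableau T" "insert_letter x T = (T1, k1)" "insert_letter y T1 = (T2, k2)"
  shows "k1 < k2 \<longleftrightarrow> y < x"
  using assms
proof (induction T arbitrary: x y T1 T2 k1 k2)
  case Nil
  then show ?case by (auto simp: row_insert_def bump_pos_def Let_def split: if_splits)
next
  case (Cons r T)
  let ?i = "bump_pos x r"
  have sr: "sorted r" and tT: "tableau T" using Cons.prems(1) by simp_all
  show ?case
  proof (cases "?i < length r")
    case False
    then have i: "?i = length r" using bump_pos_le[of x r] by simp
    then have T1: "T1 = (r @ [x]) # T" "k1 = 0"
      using Cons.prems(2) by (simp_all add: row_insert_def Let_def)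
    show ?thesis
    proof (cases "y < x")
      case True
      then have "bump_pos y (r @ [x]) < length (r @ [x])"
        using bump_pos_leI[of "length r" "r @ [x]" y] by simp
      with Cons.prems(3) T1 True show ?thesis
        by (auto simp: row_insert_def Let_def split: prod.splits)
    next
      case False
      have "length (r @ [x]) \<le> bump_pos y (r @ [x])"
        using before_bump_pos[of _ x r] i False
        by (intro bump_pos_geI) (force simp: nth_append less_Suc_eq)+
      with Cons.prems(3) T1 False show ?thesis
        by (auto simp: row_insert_def Let_def)
    qed
  next
    case True
    define r1 where "r1 = r[?i := x]"
    define a where "a = r ! ?i"
    obtain T1' k1' where ia: "insert_letter a T = (T1', k1')" by fastforce
    then have T1: "T1 = r1 # T1'" "k1 = Suc k1'"
      using Cons.prems(2) True by (simp_all add: row_insert_def Let_def r1_def a_def)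
    have xa: "x < a" using at_bump_pos[OF True] by (simp add: a_def)
    let ?j = "bump_pos y r1"
    show ?thesis
    proof (cases "?j < length r1")
      case False
      then have "k2 = 0" using Cons.prems(3) T1 by (simp add: row_insert_def Let_def)
      moreover have "\<not> y < x"
        using False bump_pos_leI[of ?i r1 y] True by (auto simp: r1_def)
      ultimately show ?thesis by simp
    next
      case jl: True
      obtain T2' k2' where ib: "insert_letter (r1 ! ?j) T1' = (T2', k2')" by fastforce
      then have k2: "k2 = Suc k2'"
        using Cons.prems(3) T1 jl by (simp add: row_insert_def Let_def)
      have IH: "k1' < k2' \<longleftrightarrow> r1 ! ?j < a" by (rule Cons.IH[OF tT ia ib])
      have "r1 ! ?j < a \<longleftrightarrow> y < x"
      proof (cases "y < x")
        case True
        have sr1: "sorted r1"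
          using sorted_row_insert[OF sr, of x] \<open>?i < length r\<close>
          by (simp add: row_insert_def Let_def r1_def)
        have "?j \<le> ?i" using True \<open>?i < length r\<close> by (intro bump_pos_leI) (simp_all add: r1_def)
        then have "r1 ! ?j \<le> r1 ! ?i"
          using sr1 \<open>?i < length r\<close> by (intro sorted_nth_mono) (simp_all add: r1_def)
        also have "r1 ! ?i = x" using \<open>?i < length r\<close> by (simp add: r1_def)
        finally show ?thesis using True xa by simp
      next
        case False
        have "Suc ?i \<le> ?j"
          using \<open>?i < length r\<close> False before_bump_pos[of _ x r]
          by (intro bump_pos_geI) (force simp: r1_def nth_list_update less_Suc_eq)+
        then have "a \<le> r1 ! ?j"
          using sorted_nth_mono[OF sr, of ?i ?j] jl by (simp add: r1_def a_def)
        with False show ?thesis by simp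
      qed
      with IH T1 k2 show ?thesis by simp
    qed
  qed
qed

lemma row_insert_inj:
  assumes r: "sorted r" "sorted r2"
    and ins: "row_insert x r = (r', Some y)" "row_insert x2 r2 = (r', Some y)"
  shows "x = x2 \<and> r = r2"
proof -
  \<comment> \<open>the changed entry is the last one below the bumped letter\<close>
  have pos: "(\<forall>j<length r'. r' ! j < y \<longleftrightarrow> j \<le> bump_pos x r) \<and> bump_pos x r < length r' \<and>
      x = r' ! bump_pos x r \<and> r = r'[bump_pos x r := y]"
    if s: "sorted r" and i: "row_insert x r = (r', Some y)" for x r
  proof -
    from i have i: "bump_pos x r < length r" "r' = r[bump_pos x r := x]" "y = r ! bump_pos x r"
      by (simp_all add: row_insert_Some)
    moreover have "r' ! j < y \<longleftrightarrow> j \<le> bump_pos x r" if j: "j < length r'" for j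
    proof (cases "j \<le> bump_pos x r")
      case True
      then show ?thesis
        using i at_bump_pos[OF i(1)] before_bump_pos[of j x r] by (cases "j = bump_pos x r") auto
    next
      case False
      then show ?thesis using i j sorted_nth_mono[OF s, of "bump_pos x r" j] by auto
    qed
    ultimately show ?thesis by auto
  qed
  note p = pos[OF r(1) ins(1)] pos[OF r(2) ins(2)]
  then have "bump_pos x r = bump_pos x2 r2" by (metis order.antisym order.refl)
  with p show ?thesis by metis
qed

lemma insert_letter_inj:
  assumes "tableau T" "tableau S" "insert_letter x T = (T', k)" "insert_letter y S = (T', k)"
    "map length T = map length S"
  shows "x = y \<and> T = S"
  using assms
proof (induction T arbitrary: x y S T' k)
  case Nil
  then show ?case by auto
next
  case (Cons r T)
  then obtain s S' where S: "S = s # S'" by (cases S) auto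
  note prems = Cons.prems[unfolded S]
  show ?case
  proof (cases k)
    case 0
    then have "row_insert x r = (hd T', None)" "row_insert y s = (hd T', None)" "tl T' = T" "tl T' = S'"
      using prems(3,4) by (auto split: prod.splits option.splits)
    then show ?thesis unfolding S by (auto simp: row_insert_None)
  next
    case (Suc k')
    from prems(3) Suc obtain r' a T1 where 1: "row_insert x r = (r', Some a)"
      "insert_letter a T = (T1, k')" "T' = r' # T1"
      by (auto split: prod.splits option.splits)
    from prems(4) Suc obtain r2 b T2 where 2: "row_insert y s = (r2, Some b)"
      "insert_letter b S' = (T2, k')" "T' = r2 # T2"
      by (auto split: prod.splits option.splits)
    have "a = b \<and> T = S'"
      using prems 1 2 by (intro Cons.IH[of S' a T1 k']) auto
    moreover from this have "x = y \<and> r = s"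
      using prems 1 2 by (intro row_insert_inj[of r s x r' a y]) auto
    ultimately show ?thesis unfolding S by simp
  qed
qed

text \<open>
  The letter \<open>y\<close> that was inserted into \<open>s\<close> is returned to the row above. It goes to the last
  place with an entry below \<open>y\<close>. Such a place exists because the row above dominates the row
  in which \<open>y\<close> stands, and it is weakly to the right of \<open>y\<close>, so the column condition survives.
\<close>

lemma row_uninsert:
  assumes s: "sorted s" and r': "sorted r'" and dom: "dominates r' (fst (row_insert y s))"
  obtains x r where "sorted r" "length r = length r'" "row_insert x r = (r', Some y)" "dominates r s"
proof -
  let ?s' = "fst (row_insert y s)" and ?j = "bump_pos y s"
  have js: "?j < length ?s'" "?s' ! ?j = y"
    using bump_pos_le[of y s] by (auto simp: row_insert_def Let_def)
  have s's: "?s' ! l = s ! l" if "l < length s" "l \<noteq> ?j" for l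
    using that by (auto simp: row_insert_def Let_def nth_append)
  have ls: "length s \<le> length ?s'" by (auto simp: row_insert_def Let_def)
  have lr: "length ?s' \<le> length r'" and lt: "\<And>l. l < length ?s' \<Longrightarrow> r' ! l < ?s' ! l"
    using dom by (auto simp: dominates_def)
  \<comment> \<open>the entries smaller than \<open>y\<close> form an initial segment of \<open>r'\<close>\<close>
  define I where "I = {l. l < length r' \<and> r' ! l < y}"
  have finI: "finite I" by (simp add: I_def)
  have jI: "?j \<in> I" using js lr lt[of ?j] by (auto simp: I_def)
  define i where "i = Max I"
  have iI: "i \<in> I" unfolding i_def using finI jI by (intro Max_in) auto
  have ji: "?j \<le> i" unfolding i_def using finI jI by (intro Max_ge)
  have il: "i < length r'" "r' ! i < y" using iI by (auto simp: I_def)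
  have after: "y \<le> r' ! l" if "i < l" "l < length r'" for l
    using that Max_ge[OF finI, of l] unfolding i_def[symmetric] by (force simp: I_def)
  define r where "r = r'[i := y]"
  have "sorted r"
    unfolding sorted_iff_nth_mono_less
  proof (intro allI impI)
    fix a b assume ab: "a < b" "b < length r"
    then have "r' ! a \<le> r' ! b" using sorted_nth_mono[OF r', of a b] by (simp add: r_def)
    moreover have "b = i \<Longrightarrow> r' ! a \<le> y" using il(2) calculation by simp
    ultimately show "r ! a \<le> r ! b"
      using ab after by (cases "a = i"; cases "b = i") (auto simp: r_def)
  qed
  moreover have "length r = length r'" by (simp add: r_def)
  moreover have "row_insert (r' ! i) r = (r', Some y)"
  proof -
    have "bump_pos (r' ! i) r = i"
    proof (rule order.antisym)
      show "bump_pos (r' ! i) r \<le> i" using il by (intro bump_pos_leI) (auto simp: r_def)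
      show "i \<le> bump_pos (r' ! i) r"
        using il sorted_nth_mono[OF r', of _ i] by (intro bump_pos_geI) (auto simp: r_def)
    qed
    then show ?thesis using il by (simp add: row_insert_Some r_def)
  qed
  moreover have "dominates r s"
    unfolding dominates_def
  proof (intro conjI allI impI)
    show "length s \<le> length r" using ls lr by (simp add: r_def)
    fix l assume l: "l < length s"
    show "r ! l < s ! l"
    proof (cases "l = i")
      case True
      have "y < s ! ?j" using l True ji by (intro at_bump_pos) simp
      also have "s ! ?j \<le> s ! i" using sorted_nth_mono[OF s ji] l True by simp
      finally show ?thesis using True il by (simp add: r_def)
    next
      case False
      have "r' ! l < ?s' ! l" using lt l ls by simp
      also have "?s' ! l \<le> s ! l"
      proof (cases "l = ?j")
        case True
        then show ?thesis using at_bump_pos[of y s] js l by simp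
      next
        case False
        then show ?thesis using s's[OF l] by simp
      qed
      finally show ?thesis using False by (simp add: r_def)
    qed
  qed
  ultimately show ?thesis by (rule that)
qed

text \<open>
  Insertion can be undone from any corner. The induction follows the row index of the corner
  upwards: the letter removed from the lower rows is known by induction to come from an
  insertion into them, and \<open>row_uninsert\<close> returns it to the current row.
\<close>

lemma insert_letter_surj:
  assumes "tableau T'" "map length T' = add_box k la" "sorted_wrt (\<ge>) la" "\<forall>l\<in>set la. 0 < l"
    "k \<le> length la"
  shows "\<exists>x T. tableau T \<and> map length T = la \<and> insert_letter x T = (T', k)"
  using assms
proof (induction k la arbitrary: T' rule: add_box.induct)
  case (1 k)
  then have "length T' = 1" "length (hd T') = 1" by (auto simp: Suc_length_conv)
  then obtain x where "T' = [[x]]" by (auto simp: length_Suc_conv)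
  with 1 show ?case by (intro exI[of _ x] exI[of _ "[]"]) simp
next
  case (2 l la)
  then obtain r' T where T': "T' = r' # T" "length r' = Suc l" "map length T = la" by auto
  then obtain x r where r': "r' = r @ [x]" "length r = l" by (auto simp: length_Suc_conv_rev)
  have "length (top_row T) \<le> l" using 2 T' by (cases T) auto
  then have "dominates r (top_row T)"
    using 2 T' r' by (auto simp: dominates_def nth_append)
  moreover have "length r \<le> bump_pos x r"
    using 2 T' r' by (intro bump_pos_geI) (auto simp: sorted_append)
  then have "bump_pos x r = length r" using bump_pos_le[of x r] by simp
  then have "row_insert x r = (r', None)" using r' by (simp add: row_insert_None)
  ultimately show ?case using 2 T' r'
    by (intro exI[of _ x] exI[of _ "r # T"]) (auto simp: sorted_append)
next
  case (3 k l la)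
  then obtain r' S' where T': "T' = r' # S'" "length r' = l" "map length S' = add_box k la" by auto
  have "\<exists>y S. tableau S \<and> map length S = la \<and> insert_letter y S = (S', k)"
    using 3 T' by (intro "3.IH") auto
  then obtain y S where S: "tableau S" "map length S = la" "insert_letter y S = (S', k)" by blast
  have "dominates r' (fst (row_insert y (top_row S)))"
    using top_row_insert_letter[of y S] S 3 T' by simp
  with 3 T' S obtain x r where "sorted r" "length r = length r'"
    "row_insert x r = (r', Some y)" "dominates r (top_row S)"
    using row_uninsert[of "top_row S" r' y] by (metis sorted_top_row tableau.simps(2))
  with S T' 3 show ?case by (intro exI[of _ x] exI[of _ "r # S"]) auto
qed

lemma tableau_shape:
  assumes "tableau T"
  shows "sorted_wrt (\<ge>) (map length T)" "\<forall>l\<in>set (map length T). 0 < l"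
proof -
  show "\<forall>l\<in>set (map length T). 0 < l" using assms by (induction T) auto
  have "\<forall>s\<in>set T. length s \<le> length (top_row T)" if "tableau T" for T
    using that
  proof (induction T)
    case (Cons r T)
    then show ?case by (auto simp: dominates_def intro: order_trans)
  qed simp
  with assms show "sorted_wrt (\<ge>) (map length T)"
  proof (induction T)
    case (Cons r T)
    then show ?case by (auto simp: dominates_def intro: order_trans)
  qed simp
qed

text \<open>
  The Robinson-Schensted correspondence. The recording word lists the rows of the new boxes
  and encodes the standard recording tableau.
\<close>

fun rsk :: "nat list \<Rightarrow> nat list list \<times> nat list" where
  "rsk [] = ([], [])"
| "rsk (x # w) = (case rsk w of (T, ks) \<Rightarrow> case insert_letter x T of (T', k) \<Rightarrow> (T', k # ks))"

fun recorded_shape :: "nat list \<Rightarrow> nat list" where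
  "recorded_shape [] = []"
| "recorded_shape (k # ks) = add_box k (recorded_shape ks)"

lemma rsk_correct:
  assumes "rsk w = (T, ks)"
  shows "tableau T" "map length T = recorded_shape ks" "mset (concat T) = mset w"
    "length ks = length w"
  using assms
proof (induction w arbitrary: T ks)
  case (Cons x w)
  {
    case 1
    with Cons.IH(1) show ?case
      by (auto split: prod.splits) (metis fst_conv tableau_insert_letter)
  next
    case 2
    with Cons.IH(2) show ?case
      by (auto split: prod.splits) (metis fst_conv snd_conv shape_insert_letter)
  next
    case 3
    with Cons.IH(3) show ?case
      by (auto split: prod.splits) (metis fst_conv content_insert_letter)
  next
    case 4
    with Cons.IH(4) show ?case by (auto split: prod.splits)
  }
qed simp_all

lemma major_index_rsk: "major_index (<) w = major_index (>) (snd (rsk w))"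
proof (induction w rule: induct_list012)
  case (3 y x w)
  obtain T ks where 0: "rsk w = (T, ks)" by fastforce
  obtain T1 k1 where 1: "insert_letter x T = (T1, k1)" by fastforce
  obtain T2 k2 where 2: "insert_letter y T1 = (T2, k2)" by fastforce
  have "k1 < k2 \<longleftrightarrow> y < x"
    using row_bumping[OF rsk_correct(1)[OF 0] 1 2] .
  then show ?case using "3.IH" 0 1 2 rsk_correct(4)[OF 0] by simp
qed simp_all

lemma rsk_inj: "rsk v = rsk w \<Longrightarrow> v = w"
proof (induction v arbitrary: w)
  case Nil
  then show ?case by (cases w) (auto split: prod.splits)
next
  case (Cons x v)
  obtain y u where w: "w = y # u"
    using Cons.prems by (cases w) (auto split: prod.splits)
  obtain T ks where 0: "rsk v = (T, ks)" by fastforce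
  obtain S js where 1: "rsk u = (S, js)" by fastforce
  from Cons.prems have "insert_letter x T = insert_letter y S" "ks = js"
    unfolding w by (auto simp: 0 1 split: prod.splits)
  moreover from this have "x = y \<and> T = S"
    using rsk_correct[OF 0] rsk_correct[OF 1] insert_letter_inj[of T S x _ _ y]
    by (metis surj_pair)
  ultimately show ?case using Cons.IH[of u] 0 1 w by simp
qed

text \<open>
  Undoing the insertions in the order prescribed by \<open>ks\<close> works for every tableau of the right
  shape. So the recording words that occur at all are paired with every tableau of their shape.
\<close>

lemma rsk_replace_tableau:
  assumes "rsk w = (T, ks)" "tableau T'" "map length T' = map length T"
  shows "\<exists>w'. rsk w' = (T', ks)"
  using assms
proof (induction w arbitrary: T ks T')
  case Nil
  then show ?case by (intro exI[of _ "[]"]) simp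
next
  case (Cons x w)
  obtain S js where 0: "rsk w = (S, js)" by fastforce
  obtain k where k: "insert_letter x S = (T, k)" "ks = k # js"
    using Cons.prems(1) 0 by (auto split: prod.splits)
  have S: "tableau S" using rsk_correct[OF 0] by simp
  have "map length T' = add_box k (map length S)"
    using Cons.prems(3) shape_insert_letter[of x S] k by simp
  then obtain y S' where S': "tableau S'" "map length S' = map length S" "insert_letter y S' = (T', k)"
    using insert_letter_surj[of T' k "map length S"] tableau_shape[OF S] Cons.prems(2)
      row_index_le[of x S] k by auto
  from Cons.IH[OF 0 S'(1,2)] obtain w' where "rsk w' = (S', js)" by blast
  then have "rsk (y # w') = (T', ks)" using S'(3) k by simp
  then show ?case by blast
qed

text \<open>
  As the words that record some sequence of \<open>n\<close> insertions, these are the standard tableaux with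
  \<open>n\<close> boxes, encoded by row indices.
\<close>

definition recordings :: "nat \<Rightarrow> nat list set" where
  "recordings n = (\<lambda>w. snd (rsk w)) ` {w. length w = n}"

lemma finite_recordings: "finite (recordings n)"
proof (rule finite_subset)
  have "set ks \<subseteq> {..<length w} \<and> length T \<le> length w" if "rsk w = (T, ks)" for w T ks
    using that
  proof (induction w arbitrary: T ks)
    case (Cons x w)
    obtain S js where 0: "rsk w = (S, js)" by fastforce
    obtain k where k: "insert_letter x S = (T, k)" "ks = k # js"
      using Cons.prems 0 by (auto split: prod.splits)
    have "length (add_box k la) \<le> Suc (length la)" for k la
      by (induction k la rule: add_box.induct) simp_all
    then have "length T \<le> Suc (length S)"
      using shape_insert_letter[of x S] k by (metis fst_conv length_map snd_conv)
    with Cons.IH[OF 0] k row_index_le[of x S] show ?case by force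
  qed simp
  then show "recordings n \<subseteq> {ks. set ks \<subseteq> {..<n} \<and> length ks = n}"
    unfolding recordings_def using rsk_correct(4) by (auto, metis lessThan_iff prod.collapse subsetD, metis prod.collapse)
  show "finite {ks. set ks \<subseteq> {..<n} \<and> length ks = n}" by (rule finite_lists_length_eq) simp
qed

definition tableaux :: "nat list \<Rightarrow> nat multiset \<Rightarrow> nat list list set" where
  "tableaux la M = {T. tableau T \<and> map length T = la \<and> mset (concat T) = M}"

lemma finite_tableaux: "finite (tableaux la M)"
proof (rule finite_imageD)
  show "finite (concat ` tableaux la M)"
    by (rule finite_subset[OF _ finite_permutations_of_multiset[of M]])
       (auto simp: tableaux_def permutations_of_multiset_def)
  show "inj_on concat (tableaux la M)"
  proof (rule inj_onI)
    fix S T assume *: "S \<in> tableaux la M" "T \<in> tableaux la M" "concat S = concat T"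
    then have "map length S = map length T" by (simp add: tableaux_def)
    then show "S = T" using *(3)
    proof (induction S arbitrary: T)
      case (Cons s S)
      then show ?case by (cases T) auto
    qed simp
  qed
qed

text \<open>
  Row insertion is a bijection between words and pairs of a recording word and a tableau of the
  recorded shape; it preserves the content, and it preserves the major index by the row
  bumping lemma.
\<close>

theorem card_words_by_recordings:
  "card {w. mset w = M \<and> P (major_index (<) w)} =
     (\<Sum>ks | ks \<in> recordings (size M) \<and> P (major_index (>) ks). card (tableaux (recorded_shape ks) M))"
proof -
  let ?K = "{ks \<in> recordings (size M). P (major_index (>) ks)}"
  let ?W = "{w. mset w = M \<and> P (major_index (<) w)}"
  have "bij_betw (\<lambda>w. (snd (rsk w), fst (rsk w))) ?W (Sigma ?K (\<lambda>ks. tableaux (recorded_shape ks) M))"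
    unfolding bij_betw_def
  proof
    show "inj_on (\<lambda>w. (snd (rsk w), fst (rsk w))) ?W"
      by (rule inj_onI) (simp add: prod_eq_iff rsk_inj)
    show "(\<lambda>w. (snd (rsk w), fst (rsk w))) ` ?W = Sigma ?K (\<lambda>ks. tableaux (recorded_shape ks) M)"
    proof (intro equalityI subsetI)
      fix p assume "p \<in> (\<lambda>w. (snd (rsk w), fst (rsk w))) ` ?W"
      then obtain w where w: "w \<in> ?W" "p = (snd (rsk w), fst (rsk w))" by blast
      obtain T ks where "rsk w = (T, ks)" by fastforce
      moreover from w have "length w = size M" by auto
      ultimately show "p \<in> Sigma ?K (\<lambda>ks. tableaux (recorded_shape ks) M)"
        using w rsk_correct[of w T ks]
        by (auto simp: recordings_def tableaux_def major_index_rsk image_iff simp del: size_mset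
              intro!: exI[of _ w])
    next
      fix p assume "p \<in> Sigma ?K (\<lambda>ks. tableaux (recorded_shape ks) M)"
      then obtain ks T where p: "p = (ks, T)" "ks \<in> ?K" "T \<in> tableaux (recorded_shape ks) M" by blast
      then obtain u where u: "snd (rsk u) = ks" by (auto simp: recordings_def)
      obtain U where U: "rsk u = (U, ks)" using u by (metis prod.collapse)
      have "\<exists>w. rsk w = (T, ks)"
        by (rule rsk_replace_tableau[OF U])
           (use p rsk_correct[OF U] in \<open>auto simp: tableaux_def\<close>)
      then obtain w where w: "rsk w = (T, ks)" by blast
      then have "w \<in> ?W" using p rsk_correct[OF w] by (simp add: tableaux_def major_index_rsk)
      with w p show "p \<in> (\<lambda>w. (snd (rsk w), fst (rsk w))) ` ?W" by (auto simp: image_iff)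
    qed
  qed
  then have "card ?W = card (Sigma ?K (\<lambda>ks. tableaux (recorded_shape ks) M))"
    by (rule bij_betw_same_card)
  also have "\<dots> = (\<Sum>ks\<in>?K. card (tableaux (recorded_shape ks) M))"
    by (rule card_SigmaI) (simp_all add: finite_recordings finite_tableaux)
  finally show ?thesis .
qed

section \<open>Schur expansions\<close>

lemma dominates_trans: "dominates r s \<Longrightarrow> dominates s u \<Longrightarrow> dominates r u"
  unfolding dominates_def by (metis le_trans less_le_trans less_trans)

lemma tableau_iff:
  "tableau t \<longleftrightarrow> (\<forall>r\<in>set t. sorted r \<and> r \<noteq> []) \<and> sorted_wrt dominates t"
proof (induction t)
  case (Cons r t)
  have "dominates r (top_row t) \<longleftrightarrow> (\<forall>s\<in>set t. dominates r s)" if "sorted_wrt dominates t"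
  proof (cases t)
    case Nil
    then show ?thesis by (simp add: dominates_def)
  next
    case (Cons s t')
    then show ?thesis using that by (auto intro: dominates_trans)
  qed
  with Cons.IH show ?case by auto
qed simp

lemma partitions_nonempty_rows:
  assumes "la \<in> partitions n"
  shows "i < length la \<Longrightarrow> 0 < la ! i" "i < i' \<Longrightarrow> i' < length la \<Longrightarrow> la ! i' \<le> la ! i"
  using assms by (auto simp: partitions_def sorted_wrt_iff_nth_less)

definition rows :: "nat list \<Rightarrow> (nat \<times> nat \<Rightarrow> nat) \<Rightarrow> nat list list" where
  "rows la T = map (\<lambda>i. map (\<lambda>j. T (i, j)) [0..<la ! i]) [0..<length la]"

lemma cells_Sigma: "cells la = Sigma {..<length la} (\<lambda>i. {..<la ! i})"
  by (auto simp: cells_def)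

lemma monomial_of_sum: "monomial_of (\<Sum>x\<in>A. f x) = (\<Sum>x\<in>A. monomial_of (f x))"
  by (induction A rule: infinite_finite_induct) (simp_all add: monomial_of_add, simp_all add: monomial_of_def)

lemma monomial_of_rows: "monomial_of (mset (concat (rows la T))) = Defs.content la T"
proof -
  have concat: "mset (concat (map f [0..<k])) = (\<Sum>i<k. mset (f i))" for f :: "nat \<Rightarrow> nat list" and k
    by (induction k) simp_all
  have map: "mset (map f [0..<k]) = (\<Sum>j<k. {#f j#})" for f :: "nat \<Rightarrow> nat" and k
    by (induction k) simp_all
  have single: "monomial_of {#x#} = Poly_Mapping.single x 1" for x
    by (simp add: monomial_of_def)
  show ?thesis
    unfolding rows_def concat map monomial_of_sum single Defs.content_def cells_Sigma
    by (simp add: sum.Sigma)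
qed

text \<open>
  Translates between fillings of the cells and lists of rows. In a partition shape
  the cell above a cell always exists, which is why comparing entries of a column
  amounts to domination between rows.
\<close>

lemma bij_betw_rows:
  assumes la: "la \<in> partitions n"
  shows "bij_betw (rows la) {T \<in> ssyt la. Defs.content la T = monomial_of M} (tableaux la M)"
  unfolding bij_betw_def
proof
  have nth: "length (rows la T) = length la" "i < length la \<Longrightarrow> length (rows la T ! i) = la ! i"
    "i < length la \<Longrightarrow> j < la ! i \<Longrightarrow> rows la T ! i ! j = T (i, j)" for T i j
    by (simp_all add: rows_def)
  show "inj_on (rows la) {T \<in> ssyt la. Defs.content la T = monomial_of M}"
  proof (rule inj_onI)
    fix S T assume *: "S \<in> {T \<in> ssyt la. Defs.content la T = monomial_of M}"
      "T \<in> {T \<in> ssyt la. Defs.content la T = monomial_of M}" "rows la S = rows la T"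
    show "S = T"
    proof (rule extensionalityI[of _ "cells la"])
      show "S \<in> extensional (cells la)" "T \<in> extensional (cells la)" using * by (simp_all add: ssyt_def)
      fix c assume "c \<in> cells la"
      then show "S c = T c" using nth(3)[of "fst c" "snd c"] *(3) by (auto simp: cells_def) (metis nth(3))
    qed
  qed
  have rows_iff: "rows la T \<in> tableaux la M \<longleftrightarrow> T \<in> ssyt la \<and> Defs.content la T = monomial_of M"
    if ext: "T \<in> extensional (cells la)" for T
  proof -
    have "map length (rows la T) = la" by (rule nth_equalityI) (simp_all add: rows_def)
    moreover have "mset (concat (rows la T)) = M \<longleftrightarrow> Defs.content la T = monomial_of M"
      by (simp add: monomial_of_eq_iff flip: monomial_of_rows)
    moreover have "(\<forall>r\<in>set (rows la T). sorted r \<and> r \<noteq> []) \<longleftrightarrow>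
        (\<forall>i j j'. j < j' \<and> (i, j) \<in> cells la \<and> (i, j') \<in> cells la \<longrightarrow> T (i, j) \<le> T (i, j'))"
      using partitions_nonempty_rows(1)[OF la]
      by (auto simp: rows_def cells_def sorted_iff_nth_mono_less)
    moreover have "sorted_wrt dominates (rows la T) \<longleftrightarrow>
        (\<forall>i i' j. i < i' \<and> (i, j) \<in> cells la \<and> (i', j) \<in> cells la \<longrightarrow> T (i, j) < T (i', j))"
    proof -
      have "dominates (rows la T ! i) (rows la T ! i') \<longleftrightarrow> (\<forall>j < la ! i'. T (i, j) < T (i', j))"
        if "i < i'" "i' < length la" for i i'
        using that partitions_nonempty_rows(2)[OF la that]
        by (auto simp: dominates_def rows_def)
      then show ?thesis
        using partitions_nonempty_rows(2)[OF la]
        by (auto simp: sorted_wrt_iff_nth_less nth(1) cells_def) (meson less_le_trans less_trans)+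
    qed
    ultimately show ?thesis using ext unfolding tableaux_def tableau_iff ssyt_def by auto
  qed
  show "rows la ` {T \<in> ssyt la. Defs.content la T = monomial_of M} = tableaux la M"
  proof (intro equalityI subsetI)
    fix t assume "t \<in> rows la ` {T \<in> ssyt la. Defs.content la T = monomial_of M}"
    then show "t \<in> tableaux la M" using rows_iff by (auto simp: ssyt_def)
  next
    fix t assume t: "t \<in> tableaux la M"
    \<comment> \<open>outside the diagram the filling must have the default value\<close>
    define T where "T = restrict (\<lambda>(i, j). t ! i ! j) (cells la)"
    have len: "map length t = la" using t by (simp add: tableaux_def)
    have "rows la T = t"
    proof (rule nth_equalityI)
      show "length (rows la T) = length t" using len by (auto simp: rows_def)
      fix i assume "i < length (rows la T)"
      then have i: "i < length la" by (simp add: rows_def)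
      then have "length (t ! i) = la ! i" using len by (metis length_map nth_map)
      with i show "rows la T ! i = t ! i"
        by (intro nth_equalityI) (simp_all add: rows_def T_def cells_def)
    qed
    moreover have "T \<in> extensional (cells la)" by (simp add: T_def)
    ultimately show "t \<in> rows la ` {T \<in> ssyt la. Defs.content la T = monomial_of M}"
      using t rows_iff[of T] by (metis (mono_tags, lifting) image_eqI mem_Collect_eq)
  qed
qed

lemma mcoeff_schur:
  assumes "la \<in> partitions n"
  shows "mcoeff (schur la) (monomial_of M) = of_nat (card (tableaux la M))"
  using bij_betw_same_card[OF bij_betw_rows[OF assms, of M]] by (simp add: schur.rep_eq)

lemma finite_partitions: "finite (partitions n)"
proof (rule finite_subset)
  have "length la \<le> sum_list la" if "\<forall>x\<in>set la. 0 < x" for la :: "nat list"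
    using that by (induction la) (auto simp: Suc_le_eq add_mono)
  then show "partitions n \<subseteq> {la. set la \<subseteq> {..n} \<and> length la \<le> n}"
    by (auto simp: partitions_def dest: member_le_sum_list)
  show "finite {la. set la \<subseteq> {..n} \<and> length la \<le> n}" by (rule finite_lists_length_le) simp
qed

lemma size_tableaux: "T \<in> tableaux la M \<Longrightarrow> size M = sum_list la"
  by (auto simp: tableaux_def length_concat)

lemma recorded_shape_partition:
  assumes "ks \<in> recordings n"
  shows "recorded_shape ks \<in> partitions n"
proof -
  obtain w T where w: "length w = n" "rsk w = (T, ks)"
    using assms unfolding recordings_def by (auto simp: prod_eq_iff) 
  note T = rsk_correct[OF w(2)]
  have "sum_list (recorded_shape ks) = size (mset (concat T))"
    unfolding T(2)[symmetric] by (simp add: length_concat)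
  also have "\<dots> = n" using T(3) w(1) by simp
  finally show ?thesis
    using tableau_shape[OF T(1)] by (simp add: partitions_def T(2))
qed

text \<open>
  By the interpretation of recording words, the number of standard tableaux of shape \<open>la\<close> with
  major index congruent to \<open>-r\<close> modulo \<open>n\<close>.
\<close>

definition ell_multiplicity :: "nat \<Rightarrow> nat \<Rightarrow> nat list \<Rightarrow> nat" where
  "ell_multiplicity n r la =
     card {ks \<in> recordings n. n dvd r + major_index (>) ks \<and> recorded_shape ks = la}"

lemma mps_eqI: "(\<And>M. mcoeff f (monomial_of M) = mcoeff g (monomial_of M)) \<Longrightarrow> f = g"
  by (metis ext mcoeff_inject monomial_of_surj)

text \<open>
  The theorem of Kraskiewicz and Weyman. Sorting the recording words in
  \<open>card_words_by_recordings\<close> by shape leaves the coefficients of Schur functions.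
\<close>

theorem ell_schur_expansion:
  assumes n: "n \<ge> 1"
  shows "ell n r = (\<Sum>la\<in>partitions n. mps_scale (of_nat (ell_multiplicity n r la)) (schur la))"
proof (rule mps_eqI)
  fix M
  have rhs: "mcoeff (\<Sum>la\<in>partitions n. mps_scale (of_nat (ell_multiplicity n r la)) (schur la)) (monomial_of M) =
      (of_nat (\<Sum>la\<in>partitions n. ell_multiplicity n r la * card (tableaux la M)) :: complex)"
    by (simp add: mcoeff_sum mps_scale.rep_eq mcoeff_schur)
  show "mcoeff (ell n r) (monomial_of M) =
    mcoeff (\<Sum>la\<in>partitions n. mps_scale (of_nat (ell_multiplicity n r la)) (schur la)) (monomial_of M)"
  proof (cases "size M = n")
    case True
    let ?K = "{ks. ks \<in> recordings n \<and> n dvd r + major_index (>) ks}"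
    have "card {w. mset w = M \<and> n dvd r + major_index (<) w} =
        (\<Sum>ks\<in>?K. card (tableaux (recorded_shape ks) M))"
      using card_words_by_recordings[of M "\<lambda>i. n dvd r + i"] True by simp
    also have "\<dots> = (\<Sum>la\<in>partitions n. \<Sum>ks | ks \<in> ?K \<and> recorded_shape ks = la.
        card (tableaux (recorded_shape ks) M))"
      by (rule sum.group[symmetric])
         (auto simp: finite_recordings finite_partitions recorded_shape_partition)
    also have "\<dots> = (\<Sum>la\<in>partitions n. ell_multiplicity n r la * card (tableaux la M))"
      by (intro sum.cong refl) (simp add: ell_multiplicity_def conj_assoc)
    finally show ?thesis unfolding rhs mcoeff_ell_words[OF n] using True by simp
  next
    case False
    then have "tableaux la M = {}" if "la \<in> partitions n" for la
      using that size_tableaux[of _ la M] by (auto simp: partitions_def)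
    then show ?thesis unfolding rhs mcoeff_ell_words[OF n] using False by simp
  qed
qed

lemma power_sums_ell_expansion:
  assumes n: "n \<ge> 1"
  shows "(\<Sum>d | d dvd n. power_sum d ^ (n div d)) =
    (\<Sum>k | k dvd n. mps_scale (ramanujan_coeff k n) (ell n (n div k)))"
proof (rule mps_eqI)
  fix M
  define P where "P d = mcoeff (power_sum d ^ (n div d) :: complex mps) (monomial_of M)" for d
  have ell: "of_nat n * mcoeff (ell n r) (monomial_of M) = (\<Sum>d | d dvd n. P d * ramanujan_sum d r)" for r
  proof -
    have "n div (n div gcd j n) = gcd j n" for j
      using n by (simp add: div_div_eq_right)
    then have "of_nat n * mcoeff (ell n r) (monomial_of M) =
        (\<Sum>j=1..n. P (n div gcd j n) * unit_root n ^ (r * j))"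
      unfolding mcoeff_ell[OF n] P_def by simp
    also have "\<dots> = (\<Sum>d | d dvd n. P d * ramanujan_sum d r)" by (rule sum_group_by_order[OF n])
    finally show ?thesis .
  qed
  have "of_nat n * (\<Sum>k | k dvd n. ramanujan_coeff k n * mcoeff (ell n (n div k)) (monomial_of M)) =
      (\<Sum>k | k dvd n. ramanujan_coeff k n * (of_nat n * mcoeff (ell n (n div k)) (monomial_of M)))"
    by (simp add: sum_distrib_left mult_ac)
  also have "\<dots> = (\<Sum>k | k dvd n. \<Sum>d | d dvd n. ramanujan_coeff k n * (P d * ramanujan_sum d (n div k)))"
    unfolding ell sum_distrib_left ..
  also have "\<dots> = (\<Sum>d | d dvd n. \<Sum>k | k dvd n. ramanujan_coeff k n * (P d * ramanujan_sum d (n div k)))"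
    by (rule sum.swap)
  also have "\<dots> = (\<Sum>d | d dvd n. P d * (\<Sum>k | k dvd n. ramanujan_coeff k n * ramanujan_sum d (n div k)))"
    by (simp add: sum_distrib_left mult_ac)
  also have "\<dots> = of_nat n * (\<Sum>d | d dvd n. P d)"
    by (simp add: ramanujan_coeff_orthogonality[OF n] sum_distrib_left mult.commute)
  finally have "(\<Sum>k | k dvd n. ramanujan_coeff k n * mcoeff (ell n (n div k)) (monomial_of M)) =
      (\<Sum>d | d dvd n. P d)"
    using n by simp
  then show "mcoeff (\<Sum>d | d dvd n. power_sum d ^ (n div d)) (monomial_of M) =
    mcoeff (\<Sum>k | k dvd n. mps_scale (ramanujan_coeff k n) (ell n (n div k))) (monomial_of M)"
    by (simp add: mcoeff_sum mps_scale.rep_eq P_def)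
qed

lemma schur_positive_sum_ell:
  fixes a :: "nat \<Rightarrow> nat"
  assumes n: "n \<ge> 1"
  shows "schur_positive n (\<Sum>k\<in>A. mps_scale (of_nat (a k)) (ell n (r k)))"
  unfolding schur_positive_def
proof (intro exI[of _ "\<lambda>la. \<Sum>k\<in>A. a k * ell_multiplicity n (r k) la"] mps_eqI)
  fix M
  let ?s = "\<lambda>la. mcoeff (schur la :: complex mps) (monomial_of M)"
  have "mcoeff (\<Sum>k\<in>A. mps_scale (of_nat (a k)) (ell n (r k))) (monomial_of M) =
      (\<Sum>k\<in>A. \<Sum>la\<in>partitions n. of_nat (a k) * (of_nat (ell_multiplicity n (r k) la) * ?s la))"
    unfolding ell_schur_expansion[OF n] by (simp add: mcoeff_sum mps_scale.rep_eq sum_distrib_left)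
  also have "\<dots> = (\<Sum>la\<in>partitions n. \<Sum>k\<in>A. of_nat (a k) * (of_nat (ell_multiplicity n (r k) la) * ?s la))"
    by (rule sum.swap)
  also have "\<dots> = mcoeff (\<Sum>la\<in>partitions n.
      mps_scale (of_nat (\<Sum>k\<in>A. a k * ell_multiplicity n (r k) la)) (schur la)) (monomial_of M)"
    by (simp add: mcoeff_sum mps_scale.rep_eq sum_distrib_right mult.assoc)
  finally show "mcoeff (\<Sum>k\<in>A. mps_scale (of_nat (a k)) (ell n (r k))) (monomial_of M) =
    mcoeff (\<Sum>la\<in>partitions n.
      mps_scale (of_nat (\<Sum>k\<in>A. a k * ell_multiplicity n (r k) la)) (schur la)) (monomial_of M)" .
qed

theorem theorem18:
  fixes n :: nat
  assumes "n \<ge> 1"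
  shows "(\<Sum>d | d dvd n. power_sum d ^ (n div d)) =
           (\<Sum>k | k dvd n. mps_scale (ramanujan_coeff k n) (ell n (n div k)))
         \<and> schur_positive n (\<Sum>d | d dvd n. (power_sum d :: complex mps) ^ (n div d))"
proof
  show expansion: "(\<Sum>d | d dvd n. power_sum d ^ (n div d)) =
      (\<Sum>k | k dvd n. mps_scale (ramanujan_coeff k n) (ell n (n div k)))"
    by (rule power_sums_ell_expansion[OF assms])
  obtain a :: "nat \<Rightarrow> nat" where a: "\<And>k. k dvd n \<Longrightarrow> ramanujan_coeff k n = of_nat (a k)"
    using ramanujan_coeff_nat[OF assms] by blast
  have "(\<Sum>d | d dvd n. (power_sum d :: complex mps) ^ (n div d)) =
      (\<Sum>k | k dvd n. mps_scale (of_nat (a k)) (ell n (n div k)))"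
    unfolding expansion by (intro sum.cong refl) (simp add: a)
  then show "schur_positive n (\<Sum>d | d dvd n. (power_sum d :: complex mps) ^ (n div d))"
    using schur_positive_sum_ell[OF assms] by simp
qed

end
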